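(* Let $N(m,n)$ denote the number of maximum independent sets (distance-$2$ MDS codes) in the Doob graph $D(m,n)$. Then $$N(m,n)=2^{2^{2m+n-1}(1+o(1))}\qquad\text{as } 2m+n\to\infty,$$ i.e. $\log_2 N(m,n) = 2^{2m+n-1}(1+o(1))$ as $2m+n\to\infty$.
   Context: The Shrikhande graph $\mathrm{Sh}$ is the graph with vertex set $\mathbb{Z}_4^2$ in which $u$ and $v$ are adjacent iff $u-v\in\{\pm(1,0),\pm(0,1),\pm(1,1)\}$. $K_4$ is the complete graph on $4$ vertices. For integers $m,n\ge 0$, $D(m,n)$ is the Cartesian product of $m$ copies of $\mathrm{Sh}$ and $n$ copies of $K_4$ (for $m=0$ this is the Hamming graph $H(n,4)$). The independence number of $D(m,n)$ is $4^{2m+n-1}$, and a maximum independent set in $D(m,n)$ (an independent set of size $4^{2m+n-1}$) is called an MDS code. *)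

theory Defs
  imports
    Complex_Main
    "Graph_Theory.Pair_Digraph"
    "HOL-Library.FuncSet"
    "HOL-Library.Landau_Symbols"
    "HOL-Library.Numeral_Type"
    "HOL-Library.Product_Plus"
begin

text \<open>
  Finite simple graphs are elements of \<open>'a pair_pre_digraph\<close> satisfying \<open>pair_graph\<close>:
  an undirected edge is a pair of opposite arcs.  The ring \<open>\<int>\<^sub>4\<close> is the numeral type \<open>4\<close>.
\<close>

definition shrikhande :: "(4 \<times> 4) pair_pre_digraph" where
  "shrikhande = \<lparr> pverts = UNIV,
     parcs = {(u, v). u - v \<in> {(1, 0), - (1, 0), (0, 1), - (0, 1), (1, 1), - (1, 1)}} \<rparr>"

definition K4 :: "4 pair_pre_digraph" where
  "K4 = \<lparr> pverts = UNIV, parcs = {(u, v). u \<noteq> v} \<rparr>"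

definition cart_prod :: "'a pair_pre_digraph \<Rightarrow> 'b pair_pre_digraph \<Rightarrow> ('a \<times> 'b) pair_pre_digraph"
  where
  "cart_prod G H = \<lparr> pverts = pverts G \<times> pverts H,
     parcs = {((a, b), (a', b')).
       (a, a') \<in> parcs G \<and> b = b' \<and> b \<in> pverts H \<or>
       a = a' \<and> a \<in> pverts G \<and> (b, b') \<in> parcs H} \<rparr>"

text \<open>
  For \<open>k = 0\<close> this is the graph with one vertex and no edges, the unit of \<open>cart_prod\<close>.
\<close>

definition cart_power :: "'a pair_pre_digraph \<Rightarrow> nat \<Rightarrow> (nat \<Rightarrow> 'a) pair_pre_digraph" where
  "cart_power G k = \<lparr> pverts = {..<k} \<rightarrow>\<^sub>E pverts G,
     parcs = {(x, y). x \<in> {..<k} \<rightarrow>\<^sub>E pverts G \<and> y \<in> {..<k} \<rightarrow>\<^sub>E pverts G \<and>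
       (\<exists>i<k. (x i, y i) \<in> parcs G \<and> (\<forall>j<k. j \<noteq> i \<longrightarrow> x j = y j))} \<rparr>"

definition doob :: "nat \<Rightarrow> nat \<Rightarrow> ((nat \<Rightarrow> 4 \<times> 4) \<times> (nat \<Rightarrow> 4)) pair_pre_digraph" where
  "doob m n = cart_prod (cart_power shrikhande m) (cart_power K4 n)"

definition independent_set :: "'a pair_pre_digraph \<Rightarrow> 'a set \<Rightarrow> bool" where
  "independent_set G S \<longleftrightarrow> S \<subseteq> pverts G \<and> (\<forall>u\<in>S. \<forall>v\<in>S. (u, v) \<notin> parcs G)"

definition maximum_independent_set :: "'a pair_pre_digraph \<Rightarrow> 'a set \<Rightarrow> bool" where
  "maximum_independent_set G S \<longleftrightarrow>
     independent_set G S \<and> (\<forall>T. independent_set G T \<longrightarrow> card T \<le> card S)"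

definition num_mds :: "nat \<Rightarrow> nat \<Rightarrow> nat" where
  "num_mds m n = card {S. maximum_independent_set (doob m n) S}"

lemma pair_graph_iff:
  "pair_graph G \<longleftrightarrow> finite (pverts G) \<and> parcs G \<subseteq> pverts G \<times> pverts G \<and>
     sym (parcs G) \<and> irrefl (parcs G)" (is "?L \<longleftrightarrow> ?R")
proof
  assume ?L
  then interpret pair_graph G .
  show ?R
    using pair_finite_verts arc_fst_in_verts arc_snd_in_verts pair_sym_arcs pair_no_loops
    by (fastforce simp: sym_def irrefl_def symmetric_def)
next
  assume R: ?R
  then have "finite (parcs G)"
    by (meson finite_SigmaI finite_subset)
  with R show ?L
    by unfold_locales (auto simp: sym_def irrefl_def symmetric_def)
qed

lemma pair_graph_shrikhande: "pair_graph shrikhande"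
proof -
  have neg: "- d \<in> {(1, 0), - (1, 0), (0, 1), - (0, 1), (1, 1), - (1, 1)}"
    if "d \<in> {(1, 0), - (1, 0), (0, 1), - (0, 1), (1, 1), - (1, 1)}" for d :: "4 \<times> 4"
    using that by auto
  have "sym (parcs shrikhande)"
  proof (rule symI)
    fix u v
    assume "(u, v) \<in> parcs shrikhande"
    then show "(v, u) \<in> parcs shrikhande"
      using neg[of "u - v"] unfolding shrikhande_def minus_diff_eq by simp
  qed
  then show ?thesis
    by (auto simp: pair_graph_iff shrikhande_def irrefl_def zero_prod_def)
qed

lemma pair_graph_K4: "pair_graph K4"
  by (auto simp: pair_graph_iff K4_def irrefl_def sym_def)

lemma pair_graph_cart_prod:
  "pair_graph G \<Longrightarrow> pair_graph H \<Longrightarrow> pair_graph (cart_prod G H)"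
  by (auto simp: pair_graph_iff cart_prod_def irrefl_def sym_def)

lemma pair_graph_cart_power: "pair_graph G \<Longrightarrow> pair_graph (cart_power G k)"
  by (auto simp: pair_graph_iff cart_power_def irrefl_def sym_def intro!: finite_PiE)

lemma pair_graph_doob: "pair_graph (doob m n)"
  by (simp add: doob_def pair_graph_cart_prod pair_graph_cart_power
      pair_graph_shrikhande pair_graph_K4)

end

theory Submission
  imports Defs
begin

text \<open>
  Lower bound: write the symbols of a \<open>K\<^sub>4\<close> coordinate as pairs of bits, and let a vertex \<open>(i, j)\<close> of a
  Shrikhande factor contribute the bits \<open>i mod 2\<close> and \<open>j mod 2\<close>.  The vertices whose first bits sum to zero
  and whose second bits sum to an arbitrary function of the first bits (of \<open>i\<close> itself for a Shrikhande
  factor) form a code, and this function has \<open>2 ^ (2 m + n - 1)\<close> arguments.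

  Upper bound: the sixteen independent 4-sets of the Shrikhande graph can be mapped injectively to
  permutations of four symbols so that disjoint sets go to disjoint permutation graphs.  Applying this map
  fibrewise turns a code in \<open>D(m, n)\<close> into a code in \<open>D(m - 1, n + 2)\<close>, hence \<open>N(m, n) \<le> N(0, 2 m + n)\<close>, and
  the latter number counts the Latin hypercubes of order 4 and dimension \<open>k = 2 m + n - 1\<close>.

  A Latin hypercube is built up along the subsets \<open>S\<close> of the coordinates: once it is known at the
  points with support properly contained in \<open>S\<close> (the boundary), the values at the points with support
  \<open>S\<close> are to be chosen.  The key fact is that three different choices exist only if the boundary is affine
  over the Klein four-group, and in that case there are at most four choices, exactly one of them affine.
  So along a chain of subsets the choice is forced as long as it is affine, it is one of at most three
  when it first fails to be affine, and one of at most two afterwards.  A chain of length \<open>l\<close> thus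
  contributes a factor of at most \<open>3 * 2 ^ l\<close>, and the \<open>2 ^ k\<close> subsets can be partitioned into
  \<open>o(2 ^ k)\<close> chains.
\<close>

section \<open>The Klein four-group and Latin hypercubes\<close>

text \<open>The difficulty of the upper bound is the leading constant: four choices at every subset
  would double the exponent, so on average only a factor 2 per subset is affordable. The surplus
  completions of an affine boundary have an explicit origin. Normalise the boundary to the sum of
  the coordinates. For nonzero e, the points whose coordinates all avoid 0 and e form a product of
  cosets of {0, e}; there the sum stays in one coset, so adding e on this box swaps two values on
  each line that meets it and preserves the Latin property. The normalisation loses nothing because
  every permutation of the Klein four-group fixing 0 is an automorphism. Conversely, three distinct
  completions with a common boundary are already pairwise distinct in some single slice of any given
  direction, which allows induction on the dimension. Non-affinity passes from a face to all larger
  faces, so a chain meets its first non-affine choice at most once; the number of chains is the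
  central binomial coefficient.\<close>

datatype klein = K0 | K1 | K2 | K3

instantiation klein :: ab_group_add
begin

definition zero_klein :: klein where "0 = K0"

fun plus_klein :: "klein \<Rightarrow> klein \<Rightarrow> klein" where
  "K0 + y = y"
| "K1 + y = (case y of K0 \<Rightarrow> K1 | K1 \<Rightarrow> K0 | K2 \<Rightarrow> K3 | K3 \<Rightarrow> K2)"
| "K2 + y = (case y of K0 \<Rightarrow> K2 | K1 \<Rightarrow> K3 | K2 \<Rightarrow> K0 | K3 \<Rightarrow> K1)"
| "K3 + y = (case y of K0 \<Rightarrow> K3 | K1 \<Rightarrow> K2 | K2 \<Rightarrow> K1 | K3 \<Rightarrow> K0)"

definition uminus_klein :: "klein \<Rightarrow> klein" where "- x = (x :: klein)"

definition minus_klein :: "klein \<Rightarrow> klein \<Rightarrow> klein" where "x - y = x + (y :: klein)"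

instance
proof
  fix a b c :: klein
  show "a + b + c = a + (b + c)" by (cases a; cases b; cases c; simp)
  show "a + b = b + a" by (cases a; cases b; simp)
  show "0 + a = a" by (simp add: zero_klein_def)
  show "- a + a = 0" by (cases a; simp add: uminus_klein_def zero_klein_def)
  show "a - b = a + - b" by (simp add: uminus_klein_def minus_klein_def)
qed

end

lemma UNIV_klein: "UNIV = {K0, K1, K2, K3}"
  by (auto intro: klein.exhaust)

instance klein :: finite
  by standard (simp add: UNIV_klein)

lemma card_klein [simp]: "card (UNIV :: klein set) = 4"
  by (simp add: UNIV_klein)

lemma klein_add_self [simp]: "x + x = (0 :: klein)"
  by (cases x; simp add: zero_klein_def)

lemma klein_add_self_left [simp]: "x + (x + y) = (y :: klein)"
  by (simp flip: add.assoc)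

lemma klein_eq_iff: "x = y \<longleftrightarrow> x + y = (0 :: klein)"
  by (cases x; cases y; simp add: zero_klein_def)

lemma klein_add_eq_0_iff [simp]: "x + y = 0 \<longleftrightarrow> x = (y :: klein)"
  by (simp flip: klein_eq_iff)

lemma klein_add_eq_iff: "x + y = z \<longleftrightarrow> x = z + (y :: klein)"
  by (cases x; cases y; cases z; simp add: zero_klein_def)

lemma all_klein: "(\<forall>x. P x) \<longleftrightarrow> P K0 \<and> P K1 \<and> P K2 \<and> P K3"
  by (metis klein.exhaust)

lemma klein_four:
  assumes "distinct [w, a, b]" "c \<notin> {w, a, b}" "c' \<notin> {w, a, b}"
  shows "c = (c' :: klein)"
proof -
  have "\<forall>w a. w \<noteq> a \<longrightarrow> (\<forall>b. b \<noteq> w \<longrightarrow> b \<noteq> a \<longrightarrow>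
    (\<forall>c. c \<notin> {w, a, b} \<longrightarrow> (\<forall>c'. c' \<notin> {w, a, b} \<longrightarrow> c = (c' :: klein))))"
    by (simp add: all_klein)
  from this[rule_format, of w a b c c'] assms show ?thesis by auto
qed

text \<open>Coordinates outside the set are pinned to 0 instead of being dropped, so faces are
  nested subsets of one function space and a single \<open>f\<close> can be restricted to all of
  them.\<close>

definition points :: "'i set \<Rightarrow> ('i \<Rightarrow> klein) set" where
  "points S = {x. \<forall>i. i \<notin> S \<longrightarrow> x i = 0}"

definition boundary :: "'i set \<Rightarrow> ('i \<Rightarrow> klein) set" where
  "boundary S = {x \<in> points S. \<exists>i\<in>S. x i = 0}"

definition latin :: "'i set \<Rightarrow> (('i \<Rightarrow> klein) \<Rightarrow> klein) \<Rightarrow> bool" where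
  "latin S f \<longleftrightarrow> (\<forall>x\<in>points S. \<forall>i\<in>S. inj (\<lambda>v. f (x(i := v))))"

lemma points_upd: "x \<in> points S \<Longrightarrow> i \<in> S \<Longrightarrow> x(i := v) \<in> points S"
  by (auto simp: points_def)

lemma points_insert_upd: "x \<in> points S \<Longrightarrow> x(i := v) \<in> points (insert i S)"
  by (auto simp: points_def)

lemma points_remove_upd: "x \<in> points (insert i S) \<Longrightarrow> x(i := 0) \<in> points S"
  by (auto simp: points_def)

lemma points_mono: "S \<subseteq> T \<Longrightarrow> points S \<subseteq> points T"
  by (auto simp: points_def)

lemma boundary_subset: "boundary S \<subseteq> points S"
  by (auto simp: boundary_def)

lemma latin_neq:
  assumes "latin S f" "x \<in> points S" "i \<in> S" "v \<noteq> w"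
  shows "f (x(i := v)) \<noteq> f (x(i := w))"
  using assms unfolding latin_def inj_def by blast

lemma latin_neq_upd:
  assumes "latin S f" "x \<in> points S" "i \<in> S" "x i \<noteq> w"
  shows "f x \<noteq> f (x(i := w))"
  using latin_neq[OF assms(1-4)] by simp

lemma latin_mono: 
  assumes "latin S f" "T \<subseteq> S" shows "latin T f"
  using assms points_mono[OF assms(2)] unfolding latin_def by blast

lemma latin_slice:
  assumes "latin (insert r T) f" "r \<notin> T"
  shows "latin T (\<lambda>x. f (x(r := c)))"
  unfolding latin_def
proof (intro ballI)
  fix x i assume x: "x \<in> points T" and i: "i \<in> T"
  then have "i \<noteq> r" using assms(2) by auto
  then have "(\<lambda>v. f ((x(i := v))(r := c))) = (\<lambda>v. f ((x(r := c))(i := v)))"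
    by (simp add: fun_upd_twist)
  moreover have "inj (\<lambda>v. f ((x(r := c))(i := v)))"
    using assms(1) points_insert_upd[OF x, of r c] i unfolding latin_def by blast
  ultimately show "inj (\<lambda>v. f ((x(i := v))(r := c)))" by simp
qed

lemma sum_upd:
  fixes x :: "'i \<Rightarrow> klein"
  assumes "finite S" "i \<in> S"
  shows "sum (x(i := v)) S = sum x S + x i + v"
proof -
  have "sum (x(i := v)) S = v + sum x (S - {i})"
    using assms by (subst sum.remove[of _ i]) (auto intro!: arg_cong2[of _ _ _ _ "(+)"] sum.cong)
  moreover have "sum x S = x i + sum x (S - {i})"
    using assms by (rule sum.remove)
  ultimately show ?thesis by (simp add: ac_simps)
qed

text \<open>The coordinates of \<open>x\<close> are exchanged for those of \<open>y\<close> one at a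
  time. The step also supplies that every coordinate of the intermediate point comes from
  \<open>x\<close> or \<open>y\<close>, so a coordinatewise condition on both ends, such as lying in
  a box, holds on the way.\<close>

lemma points_change_induct [consumes 3, case_names start step]:
  assumes "finite S" "x \<in> points S" "y \<in> points S"
    and "P x"
    and "\<And>z i. z \<in> points S \<Longrightarrow> (\<And>j. z j \<in> {x j, y j}) \<Longrightarrow> i \<in> S \<Longrightarrow> P z \<Longrightarrow> P (z(i := y i))"
  shows "P y"
proof -
  have "P (\<lambda>i. if i \<in> T then y i else x i)" if "finite T" "T \<subseteq> S" for T
    using that
  proof (induction T)
    case empty
    then show ?case using assms(4) by simp
  next
    case (insert i T)
    let ?z = "\<lambda>i. if i \<in> T then y i else x i"
    have "?z \<in> points S" using assms(2,3) by (auto simp: points_def)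
    then have "P (?z(i := y i))" using insert by (intro assms(5)) auto
    moreover have "?z(i := y i) = (\<lambda>j. if j \<in> insert i T then y j else x j)" by auto
    ultimately show ?case by simp
  qed
  from this[of S] have "P (\<lambda>i. if i \<in> S then y i else x i)" using assms(1) by simp
  moreover have "(\<lambda>i. if i \<in> S then y i else x i) = y"
    using assms(2,3) by (auto simp: points_def)
  ultimately show ?thesis by simp
qed

section \<open>Flip sums: the Latin completions of the coordinate sum\<close>

definition flip_box :: "'i set \<Rightarrow> klein \<Rightarrow> ('i \<Rightarrow> klein) \<Rightarrow> bool" where
  "flip_box S e x \<longleftrightarrow> (\<forall>i\<in>S. x i \<noteq> 0 \<and> x i \<noteq> e)"

definition flip_sum :: "'i set \<Rightarrow> klein \<Rightarrow> ('i \<Rightarrow> klein) \<Rightarrow> klein" where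
  "flip_sum S e x = sum x S + (if flip_box S e x then e else 0)"

lemma flip_sum_0 [simp]: "flip_sum S 0 x = sum x S"
  by (simp add: flip_sum_def)

text \<open>Here \<open>p\<close> and \<open>q\<close> are values of one coordinate inside the box,
  \<open>y\<close> is the value of another coordinate, and \<open>dp\<close>, \<open>dq\<close>,
  \<open>de\<close> are the defects (value plus sum) at \<open>p\<close>, \<open>q\<close>,
  \<open>e\<close>. A defect never equals a nonzero coordinate of its point; with injectivity on the
  line this leaves only \<open>e\<close> for \<open>dq\<close>.\<close>

lemma flip_line:
  assumes "e \<noteq> 0" "p \<noteq> 0" "p \<noteq> e" "q \<noteq> 0" "q \<noteq> e" "y \<noteq> 0" "y \<noteq> e"
    and "de \<noteq> e" "de \<noteq> y" "dq \<noteq> q" "dq \<noteq> y" "dp = e"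
    and "p + dp \<noteq> e + de" "p \<noteq> q \<longrightarrow> p + dp \<noteq> q + dq" "q + dq \<noteq> e + de"
    and "p = q \<longrightarrow> dq = e"
  shows "dq = (e :: klein)"
proof -
  have "\<forall>e. e \<noteq> 0 \<longrightarrow> (\<forall>p. p \<noteq> 0 \<longrightarrow> p \<noteq> e \<longrightarrow> (\<forall>q. q \<noteq> 0 \<longrightarrow> q \<noteq> e \<longrightarrow>
    (\<forall>y. y \<noteq> 0 \<longrightarrow> y \<noteq> e \<longrightarrow> (\<forall>dq. dq \<noteq> q \<longrightarrow> dq \<noteq> y \<longrightarrow> (p \<noteq> q \<longrightarrow> p + e \<noteq> q + dq) \<longrightarrow>
    (p = q \<longrightarrow> dq = e) \<longrightarrow>
    (\<forall>de. de \<noteq> e \<longrightarrow> de \<noteq> y \<longrightarrow> p + e \<noteq> e + de \<longrightarrow> q + dq \<noteq> e + de \<longrightarrow> dq = (e :: klein))))))"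
    by (simp add: all_klein zero_klein_def)
  from this[rule_format, of e p q y dq de] assms show ?thesis by blast
qed

text \<open>A nonzero defect \<open>e\<close> forces its point into the box of \<open>e\<close>,
  \<open>flip_line\<close> carries it through the whole box, and boxes of different nonzero values
  meet, so only one value occurs. In dimension one a 3-cycle of the nonzero symbols would be a
  counterexample; \<open>two\<close> excludes that case.\<close>

theorem latin_eq_flip_sum:
  assumes "finite S" and two: "\<And>i. i \<in> S \<Longrightarrow> \<exists>j\<in>S. j \<noteq> i"
    and f: "latin S f" and bd: "\<And>x. x \<in> boundary S \<Longrightarrow> f x = sum x S"
  shows "\<exists>e. \<forall>x\<in>points S. f x = flip_sum S e x"
proof -
  define d where "d x = f x + sum x S" for x
  have f_eq: "f x = sum x S + d x" for x by (simp add: d_def ac_simps)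
  have d0: "d x = 0" if "x \<in> boundary S" for x using bd[OF that] by (simp add: d_def)
  \<comment> \<open>Otherwise \<open>f\<close> would repeat at \<open>x\<close> its value at the
    boundary point \<open>x(i := 0)\<close> of the same line.\<close>
  have d_neq: "d x \<noteq> x i" if "x \<in> points S" "i \<in> S" "x i \<noteq> 0" for x i
  proof
    assume *: "d x = x i"
    have "x(i := 0) \<in> boundary S" using that by (auto simp: boundary_def points_def)
    then have "f (x(i := 0)) = sum x S + x i"
      using bd sum_upd[OF assms(1) that(2), of x 0] by simp
    moreover have "f x = sum x S + x i" using * f_eq by simp
    ultimately show False using latin_neq_upd[OF f that(1,2,3)] by simp
  qed
  have d_line: "v + d (x(i := v)) \<noteq> w + d (x(i := w))" if "x \<in> points S" "i \<in> S" "v \<noteq> w" for x i v w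
    using latin_neq[OF f that] sum_upd[OF assms(1) that(2), of x]
    by (auto simp: f_eq add.assoc)
  have spread: "d (x(i := q)) = e"
    if x: "x \<in> points S" "flip_box S e x" and "d x = e" "e \<noteq> 0" "i \<in> S" "q \<noteq> 0" "q \<noteq> e" for x i q e
  proof -
    obtain j where j: "j \<in> S" "j \<noteq> i" using two[OF \<open>i \<in> S\<close>] by auto
    have upd: "x(i := v) \<in> points S" for v using x(1) \<open>i \<in> S\<close> by (rule points_upd)
    have 1: "d (x(i := v)) \<noteq> v" if "v \<noteq> 0" for v
      using d_neq[OF upd \<open>i \<in> S\<close>, of v] that by simp
    have 2: "d (x(i := v)) \<noteq> x j" for v
      using d_neq[OF upd j(1), of v] j x(2) by (simp add: flip_box_def)
    have 3: "x i \<noteq> 0" "x i \<noteq> e" "x j \<noteq> 0" "x j \<noteq> e"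
      using x(2) j(1) \<open>i \<in> S\<close> by (auto simp: flip_box_def)
    show ?thesis
    proof (rule flip_line[where p = "x i" and y = "x j" and de = "d (x(i := e))" and dp = "d x"])
      show "x i + d x \<noteq> e + d (x(i := e))"
        using d_line[OF x(1) \<open>i \<in> S\<close> 3(2)] by simp
      show "q + d (x(i := q)) \<noteq> e + d (x(i := e))"
        using d_line[OF x(1) \<open>i \<in> S\<close> \<open>q \<noteq> e\<close>] by simp
      show "x i \<noteq> q \<longrightarrow> x i + d x \<noteq> q + d (x(i := q))"
        using d_line[OF x(1) \<open>i \<in> S\<close>, of "x i" q] by simp
      show "x i = q \<longrightarrow> d (x(i := q)) = e" using \<open>d x = e\<close> by auto
    qed (use that 3 1 2 in auto)
  qed
  have all: "d y = e" if x: "x \<in> points S" "d x = e" "e \<noteq> 0" and y: "y \<in> points S" "flip_box S e y" for x y e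
  proof -
    have box: "flip_box S e x" unfolding flip_box_def
    proof
      fix i assume "i \<in> S"
      have "x i \<noteq> 0" using d0[of x] x \<open>i \<in> S\<close> by (auto simp: boundary_def)
      with d_neq[OF x(1) \<open>i \<in> S\<close>] x(2) show "x i \<noteq> 0 \<and> x i \<noteq> e" by auto
    qed
    from assms(1) x(1) y(1) show ?thesis
    proof (induction rule: points_change_induct)
      case start
      then show ?case by (rule x(2))
    next
      case (step z i)
      have "flip_box S e z" unfolding flip_box_def
      proof
        fix j assume "j \<in> S"
        with step(2)[of j] box y(2) show "z j \<noteq> 0 \<and> z j \<noteq> e" by (auto simp: flip_box_def)
      qed
      moreover have "y i \<noteq> 0" "y i \<noteq> e" using y(2) step(3) by (auto simp: flip_box_def)
      ultimately show ?case using spread[OF step(1) _ step(4) x(3) step(3)] by blast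
    qed
  qed
  show ?thesis
  proof (cases "\<exists>x\<in>points S. d x \<noteq> 0")
    case False
    then show ?thesis by (intro exI[of _ 0]) (auto simp: f_eq)
  next
    case True
    then obtain x e where x: "x \<in> points S" "d x = e" "e \<noteq> 0" by auto
    have "d y = (if flip_box S e y then e else 0)" if y: "y \<in> points S" for y
    proof (cases "flip_box S e y")
      case True
      with all[OF x y] show ?thesis by simp
    next
      case False
      have "d y = 0"
      proof (rule ccontr)
        assume nz: "d y \<noteq> 0"
        define e' where "e' = d y"
        have ne: "e' \<noteq> e"
        proof
          assume "e' = e"
          moreover have "flip_box S e' y" unfolding flip_box_def
          proof
            fix i assume "i \<in> S"
            have "y i \<noteq> 0" using d0[of y] y nz \<open>i \<in> S\<close> by (auto simp: boundary_def)
            with d_neq[OF y \<open>i \<in> S\<close>] show "y i \<noteq> 0 \<and> y i \<noteq> e'" by (auto simp: e'_def)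
          qed
          ultimately show False using False by simp
        qed
        \<comment> \<open>The constant \<open>e + e'\<close> differs from 0, \<open>e\<close> and
          \<open>e'\<close>, so this point lies in both boxes and would have both defects.\<close>
        define z where "z i = (if i \<in> S then e + e' else 0)" for i
        have z: "z \<in> points S" by (simp add: z_def points_def)
        have "e + e' \<noteq> 0" "e + e' \<noteq> e" "e + e' \<noteq> e'"
          using ne nz x(3) by (auto simp: e'_def[symmetric])
        then have "flip_box S e z" "flip_box S e' z" by (auto simp: flip_box_def z_def)
        then have "d z = e" "d z = e'" using all[OF x z] all[OF y e'_def[symmetric] _ z] nz
          by (auto simp: e'_def[symmetric])
        with ne show False by simp
      qed
      with False show ?thesis by simp
    qed
    then show ?thesis by (intro exI[of _ e]) (auto simp: f_eq flip_sum_def)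
  qed
qed

text \<open>\<open>D0\<close>, \<open>Da\<close>, \<open>Db\<close>, \<open>De\<close> are the
  defects on a line at the values 0, \<open>a\<close>, \<open>b\<close>, \<open>a + b\<close>, and
  \<open>M\<close> says that the other coordinates fit the box of \<open>a\<close>. Each defect is
  \<open>b\<close> or one other value; injectivity ties these binary choices together.\<close>

lemma eps_line:
  fixes a b :: klein
  assumes "a \<noteq> 0" "b \<noteq> 0" "a \<noteq> b"
    and "D0 = a \<or> D0 = b" "Da = a \<or> Da = b"
    and "Db = (if M then 0 else a) \<or> Db = b" "De = (if M then 0 else a) \<or> De = b"
    and "D0 \<noteq> a + Da" "D0 \<noteq> b + Db" "D0 \<noteq> a + b + De" "a + Da \<noteq> b + Db" "a + Da \<noteq> a + b + De"
      "b + Db \<noteq> a + b + De"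
  shows "(D0 = b \<longleftrightarrow> De = b) \<and> (Da = b \<longleftrightarrow> Db = b) \<and> (M \<longrightarrow> (De = b \<longleftrightarrow> Db = b))"
  using assms by (cases M) (auto simp: ac_simps)

lemma klein_other:
  assumes "a \<noteq> 0" "b \<noteq> 0" "a \<noteq> b" "x \<noteq> 0" "x \<noteq> a" "x \<noteq> b"
  shows "x = a + (b :: klein)"
  using klein_four[of 0 a b x "a + b"] assms by auto

text \<open>\<open>g\<close> is one of three completions, flipped by \<open>a\<close> in slice
  \<open>c\<close>; \<open>gb\<close> and \<open>ge\<close> are the traces of the other two, which
  are flipped by \<open>b\<close> and \<open>e\<close> there and share slice 0 with
  \<open>g\<close>. Avoiding all three flip sums pins down slice 0, and this rigidity spreads to the
  other slices. The conclusion splits off coordinate \<open>r\<close>.\<close>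

lemma affine_boundary_step:
  fixes g :: "('i \<Rightarrow> klein) \<Rightarrow> klein"
  assumes fin: "finite T" and ne: "T \<noteq> {}" and r: "r \<notin> T" and g: "latin (insert r T) g"
    and c: "c \<noteq> 0" and ab: "a \<noteq> 0" "b \<noteq> 0" "a \<noteq> b"
    and gc: "\<And>x. x \<in> points T \<Longrightarrow> g (x(r := c)) = flip_sum T a x"
    and gb: "\<And>x. x \<in> points T \<Longrightarrow> g x \<noteq> flip_sum T b x"
    and ge: "\<And>x. x \<in> points T \<Longrightarrow> g x \<noteq> flip_sum T e x" and e: "e \<noteq> a" "e \<noteq> b"
    and x: "x \<in> boundary (insert r T)"
  shows "g x = sum x T + g ((\<lambda>_. 0)(r := x r))"
proof -
  have pt: "x \<in> points (insert r T)" if "x \<in> points T" for x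
    using that points_mono[of T "insert r T"] by auto
  have zero_r: "x(r := 0) = x" if "x \<in> points T" for x :: "'i \<Rightarrow> klein"
    using that r by (auto simp: points_def)
  have line_r: "g (x(r := v)) \<noteq> g (x(r := w))" if "x \<in> points T" "v \<noteq> w" for x v w
    using latin_neq[OF g pt[OF that(1)] _ that(2), of r] by simp
  have ga: "g x \<noteq> flip_sum T a x" if "x \<in> points T" for x
    using line_r[OF that, of 0 c] c gc[OF that] zero_r[OF that] by simp
  have na: "g x + sum x T \<noteq> a" if "x \<in> points T" "flip_box T a x" for x
    using ga[OF that(1)] that(2) by (auto simp: flip_sum_def)
  have nb: "g x + sum x T \<noteq> b" if "x \<in> points T" "flip_box T b x" for x
    using gb[OF that(1)] that(2) by (auto simp: flip_sum_def)
  \<comment> \<open>Outside the box of \<open>a\<close> or of \<open>b\<close>, one of the avoided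
    flip sums is the plain sum. A point in both boxes has all coordinates \<open>a + b\<close>, and
    there the flip by \<open>e\<close>, which is 0 or \<open>a + b\<close>, adds nothing.\<close>
  have n0: "g x + sum x T \<noteq> 0" if "x \<in> points T" for x
  proof (cases "flip_box T a x \<and> flip_box T b x")
    case True
    have "x i = a + b" if "i \<in> T" for i
      using True that ab klein_other[of a b "x i"] by (auto simp: flip_box_def)
    moreover have "e = 0 \<or> e = a + b" using klein_other[of a b e] ab e by auto
    ultimately have "flip_sum T e x = sum x T"
      using ne by (auto simp: flip_sum_def flip_box_def)
    with ge[OF that] show ?thesis by auto
  next
    case False
    with ga[OF that] gb[OF that] show ?thesis by (auto simp: flip_sum_def)
  qed
  \<comment> \<open>Replacing a coordinate \<open>x i\<close> by \<open>a + b\<close> excludes the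
    defect \<open>x i\<close>, by induction. If no coordinate equals \<open>a\<close>, the point
    lies in the box of \<open>a\<close>, which excludes the defect \<open>a\<close>; likewise for
    \<open>b\<close>.\<close>
  have no_zeros: "g x + sum x T = a + b" if "x \<in> points T" "\<And>i. i \<in> T \<Longrightarrow> x i \<noteq> 0" for x
    using that
  proof (induction "card {i \<in> T. x i \<noteq> a + b}" arbitrary: x rule: less_induct)
    case less
    have neq: "g x + sum x T \<noteq> x i" if i: "i \<in> T" "x i \<noteq> a + b" for i
    proof -
      let ?y = "x(i := a + b)"
      have y: "?y \<in> points T" using less.prems(1) i(1) by (rule points_upd)
      have "{j \<in> T. ?y j \<noteq> a + b} \<subset> {j \<in> T. x j \<noteq> a + b}" using i by auto
      then have "card {j \<in> T. ?y j \<noteq> a + b} < card {j \<in> T. x j \<noteq> a + b}"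
        using fin by (intro psubset_card_mono) auto
      moreover have "?y j \<noteq> 0" if "j \<in> T" for j using that less.prems(2) ab by auto
      ultimately have "g ?y + sum ?y T = a + b" using less.hyps y by blast
      then have "g ?y = sum x T + x i"
        using sum_upd[OF fin i(1), of x "a + b"] by (simp add: klein_add_eq_iff ac_simps)
      moreover have "g x \<noteq> g ?y"
        using latin_neq_upd[OF g pt[OF less.prems(1)]] i by auto
      ultimately show ?thesis by (auto simp: klein_add_eq_iff ac_simps)
    qed
    have "g x + sum x T \<noteq> a"
    proof (cases "\<exists>i\<in>T. x i = a")
      case True
      then obtain i where "i \<in> T" "x i = a" by auto
      with neq[of i] ab show ?thesis by auto
    next
      case False
      with less.prems na show ?thesis by (auto simp: flip_box_def)
    qed
    moreover have "g x + sum x T \<noteq> b"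
    proof (cases "\<exists>i\<in>T. x i = b")
      case True
      then obtain i where "i \<in> T" "x i = b" by auto
      with neq[of i] ab show ?thesis by auto
    next
      case False
      with less.prems nb show ?thesis by (auto simp: flip_box_def)
    qed
    ultimately show ?case using klein_other[OF ab] n0[OF less.prems(1)] by blast
  qed
  \<comment> \<open>On a line through a zero coordinate, the three other points have defect
    \<open>a + b\<close> by induction, and the one value left gives the same defect at 0.\<close>
  have g0: "g x + sum x T = a + b" if "x \<in> points T" for x
    using that
  proof (induction "card {i \<in> T. x i = 0}" arbitrary: x rule: less_induct)
    case less
    show ?case
    proof (cases "\<exists>i\<in>T. x i = 0")
      case False
      with less.prems no_zeros show ?thesis by blast
    next
      case True
      then obtain i where i: "i \<in> T" "x i = 0" by auto
      have val: "g x + sum x T \<noteq> a + b + v" if "v \<noteq> 0" for v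
      proof -
        let ?y = "x(i := v)"
        have y: "?y \<in> points T" using less.prems i(1) by (rule points_upd)
        have "{j \<in> T. ?y j = 0} \<subset> {j \<in> T. x j = 0}" using i that by auto
        then have "card {j \<in> T. ?y j = 0} < card {j \<in> T. x j = 0}"
          using fin by (intro psubset_card_mono) auto
        then have "g ?y + sum ?y T = a + b" using less.hyps y by blast
        then have "g ?y = sum x T + (a + b + v)"
          using sum_upd[OF fin i(1), of x v] i(2) by (simp add: klein_add_eq_iff ac_simps)
        moreover have "g x \<noteq> g ?y"
          using latin_neq_upd[OF g pt[OF less.prems], of i v] i that by auto
        ultimately show ?thesis by (auto simp: klein_add_eq_iff ac_simps)
      qed
      show ?thesis using klein_other[OF ab] val[of a] val[of b] val[of "a + b"] ab
        by (auto simp: ac_simps)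
    qed
  qed
  \<comment> \<open>Slice 0 excludes the defect \<open>a + b\<close>, and slice \<open>c\<close>
    excludes \<open>a\<close> or 0 depending on the box, so only \<open>b\<close> and one other
    value remain. It is then shown that the defect is \<open>b\<close> everywhere or
    nowhere.\<close>
  have slice: "g (x(r := d)) = sum x T + g ((\<lambda>_. 0)(r := d))"
    if d: "d \<noteq> 0" "d \<noteq> c" and x: "x \<in> points T" "\<exists>i\<in>T. x i = 0" for d x
  proof -
    define D where "D x = g (x(r := d)) + sum x T" for x
    have gD: "g (x(r := d)) = sum x T + D x" for x by (simp add: D_def ac_simps)
    have D_e: "D x \<noteq> a + b" if "x \<in> points T" for x
      using line_r[OF that d(1)] g0[OF that] zero_r[OF that] by (auto simp: D_def klein_add_eq_iff)
    have D_c: "D x \<noteq> (if flip_box T a x then a else 0)" if "x \<in> points T" for x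
      using line_r[OF that d(2)] gc[OF that] by (auto simp: D_def flip_sum_def klein_add_eq_iff ac_simps)
    have D_in: "D x = (if flip_box T a x then 0 else a) \<or> D x = b" if "x \<in> points T" for x
      using D_e[OF that] D_c[OF that] klein_other[OF ab, of "D x"] by (auto split: if_splits)
    have D_line: "v + D (x(i := v)) \<noteq> w + D (x(i := w))" if "x \<in> points T" "i \<in> T" "v \<noteq> w" for x i v w
      using latin_neq[OF latin_slice[OF g r, of d] that] sum_upd[OF fin that(2), of x]
      by (auto simp: gD add.assoc)
    have lines: "(D (x(i := 0)) = b \<longleftrightarrow> D (x(i := a + b)) = b) \<and> (D (x(i := a)) = b \<longleftrightarrow> D (x(i := b)) = b)
       \<and> ((\<forall>j\<in>T - {i}. x j \<noteq> 0 \<and> x j \<noteq> a) \<longrightarrow> (D (x(i := a + b)) = b \<longleftrightarrow> D (x(i := b)) = b))"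
      if xi: "x \<in> points T" "i \<in> T" for x i
    proof (rule eps_line[OF ab])
      have upd: "x(i := v) \<in> points T" for v using xi by (rule points_upd)
      have box: "flip_box T a (x(i := v)) \<longleftrightarrow> v \<noteq> 0 \<and> v \<noteq> a \<and> (\<forall>j\<in>T - {i}. x j \<noteq> 0 \<and> x j \<noteq> a)" for v
        using xi(2) by (auto simp: flip_box_def)
      show "D (x(i := 0)) = a \<or> D (x(i := 0)) = b" using D_in[OF upd, of 0] by (auto simp: box)
      show "D (x(i := a)) = a \<or> D (x(i := a)) = b" using D_in[OF upd, of a] by (auto simp: box)
      show "D (x(i := b)) = (if \<forall>j\<in>T - {i}. x j \<noteq> 0 \<and> x j \<noteq> a then 0 else a) \<or> D (x(i := b)) = b"
        using D_in[OF upd, of b] ab by (auto simp: box split: if_splits)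
      show "D (x(i := a + b)) = (if \<forall>j\<in>T - {i}. x j \<noteq> 0 \<and> x j \<noteq> a then 0 else a) \<or> D (x(i := a + b)) = b"
        using D_in[OF upd, of "a + b"] ab by (auto simp: box split: if_splits)
      note dl = D_line[OF xi]
      show "D (x(i := 0)) \<noteq> a + D (x(i := a))" using dl[of 0 a] ab by simp
      show "D (x(i := 0)) \<noteq> b + D (x(i := b))" using dl[of 0 b] ab by simp
      show "D (x(i := 0)) \<noteq> a + b + D (x(i := a + b))" using dl[of 0 "a + b"] ab by simp
      show "a + D (x(i := a)) \<noteq> b + D (x(i := b))" using dl[of a b] ab by simp
      show "a + D (x(i := a)) \<noteq> a + b + D (x(i := a + b))" using dl[of a "a + b"] ab by simp
      show "b + D (x(i := b)) \<noteq> a + b + D (x(i := a + b))" using dl[of b "a + b"] ab by simp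
    qed
    define z where "z i = (if i \<in> T then a + b else 0)" for i
    have z: "z \<in> points T" by (simp add: z_def points_def)
    have const: "D x = b \<longleftrightarrow> D z = b" if x: "x \<in> points T" for x
    proof -
      \<comment> \<open>By \<open>lines\<close>, 0 can always be moved to \<open>a + b\<close> and
        \<open>a\<close> to \<open>b\<close>. At the resulting point all coordinates avoid 0 and
        \<open>a\<close>, so the conditional link applies and moves \<open>b\<close> to
        \<open>a + b\<close>, ending at \<open>z\<close>.\<close>
      define y where "y i = (if i \<in> T then if x i \<in> {0, a + b} then a + b else b else 0)" for i
      have y: "y \<in> points T" by (simp add: y_def points_def)
      have "D x = b \<longleftrightarrow> D y = b"
        using fin x y
      proof (induction rule: points_change_induct)
        case start
        show ?case by simp
      next
        case (step w i)
        have "D w = b \<longleftrightarrow> D (w(i := y i)) = b"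
        proof (cases "w i = y i")
          case True
          then have "w(i := y i) = w" by auto
          then show ?thesis by simp
        next
          case False
          then have wi: "w i = x i" using step(2)[of i] by auto
          with False step(3) have "w i = 0 \<and> y i = a + b \<or> w i = a \<and> y i = b"
            using klein_other[OF ab, of "w i"] by (auto simp: y_def split: if_splits)
          moreover have "(D (w(i := 0)) = b \<longleftrightarrow> D (w(i := a + b)) = b)" "(D (w(i := a)) = b \<longleftrightarrow> D (w(i := b)) = b)"
            using lines[OF step(1,3)] by auto
          ultimately show ?thesis using fun_upd_triv[of w i] by metis
        qed
        with step(4) show ?case by blast
      qed
      also have "\<dots> \<longleftrightarrow> D z = b"
        using fin y z
      proof (induction rule: points_change_induct)
        case start
        show ?case by simp
      next
        case (step w i)
        have wv: "w j = b \<or> w j = a + b" if "j \<in> T" for j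
          using step(2)[of j] that by (auto simp: y_def z_def split: if_splits)
        have "\<forall>j\<in>T - {i}. w j \<noteq> 0 \<and> w j \<noteq> a"
        proof
          fix j assume "j \<in> T - {i}"
          with wv[of j] ab show "w j \<noteq> 0 \<and> w j \<noteq> a" by auto
        qed
        then have "D (w(i := a + b)) = b \<longleftrightarrow> D (w(i := b)) = b" using lines[OF step(1,3)] by blast
        moreover have "z i = a + b" using step(3) by (simp add: z_def)
        ultimately have "D (w(i := z i)) = b \<longleftrightarrow> D w = b"
          using wv[OF step(3)] fun_upd_triv[of w i] by metis
        with step(4) show ?case by blast
      qed
      finally show ?thesis .
    qed
    have zero: "(\<lambda>_. 0) \<in> points T" by (simp add: points_def)
    have "\<not> flip_box T a x" using x(2) by (auto simp: flip_box_def)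
    moreover have "\<not> flip_box T a (\<lambda>_. 0)" using ne by (auto simp: flip_box_def)
    ultimately have "D x = D (\<lambda>_. 0)"
      using D_in[OF x(1)] D_in[OF zero] const[OF x(1)] const[OF zero] by auto
    then show ?thesis using gD[of x] gD[of "\<lambda>_. 0"] by simp
  qed
  define y where "y = x(r := 0)"
  have y: "y \<in> points T" using x points_remove_upd by (auto simp: y_def boundary_def)
  have xy: "x = y(r := x r)" by (simp add: y_def)
  have sum_eq: "sum x T = sum y T" using r by (auto simp: y_def intro!: sum.cong)
  have zero: "(\<lambda>_. 0) \<in> points T" by (simp add: points_def)
  have nbox0: "\<not> flip_box T a (\<lambda>_. 0)" using ne by (auto simp: flip_box_def)
  show ?thesis
  proof (cases "x r = 0")
    case True
    then have "x = y" by (auto simp: y_def)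
    then show ?thesis using g0[OF y] g0[OF zero] True zero_r[OF zero]
      by (simp add: klein_add_eq_iff ac_simps)
  next
    case nz: False
    then have zy: "\<exists>i\<in>T. y i = 0" using x by (auto simp: boundary_def y_def)
    show ?thesis
    proof (cases "x r = c")
      case True
      have "\<not> flip_box T a y" using zy by (auto simp: flip_box_def)
      then show ?thesis using gc[OF y] gc[OF zero] nbox0 True xy sum_eq
        by (simp add: flip_sum_def)
    next
      case False
      from slice[OF nz False y zy] show ?thesis using xy sum_eq by simp
    qed
  qed
qed

lemma latin_third_slice:
  assumes f: "latin (insert r T) f" and g: "latin (insert r T) g"
    and x: "x \<in> points T"
    and cs: "distinct [c0, c1, c2]" and eq: "\<And>c. c \<in> {c0, c1, c2} \<Longrightarrow> f (x(r := c)) = g (x(r := c))"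
  shows "f (x(r := c)) = g (x(r := c))"
proof (cases "c \<in> {c0, c1, c2}")
  case False
  have x': "x \<in> points (insert r T)" using x by (auto simp: points_def)
  have eqs: "f (x(r := c0)) = g (x(r := c0))" "f (x(r := c1)) = g (x(r := c1))"
    "f (x(r := c2)) = g (x(r := c2))" using eq by auto
  note nf = latin_neq[OF f x', of r] and ng = latin_neq[OF g x', of r]
  show ?thesis
  proof (rule klein_four[of "f (x(r := c0))" "f (x(r := c1))" "f (x(r := c2))"])
    show "distinct [f (x(r := c0)), f (x(r := c1)), f (x(r := c2))]" using cs nf by auto
    show "f (x(r := c)) \<notin> {f (x(r := c0)), f (x(r := c1)), f (x(r := c2))}" using False nf by auto
    show "g (x(r := c)) \<notin> {f (x(r := c0)), f (x(r := c1)), f (x(r := c2))}"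
      unfolding eqs using False ng by auto
  qed
qed (use eq in auto)

text \<open>If two of \<open>f\<close>, \<open>g\<close>, \<open>h\<close> agreed in each of the three slices, then every slice would be shared by a
  different pair, and comparing the four values on a line would make two of the functions equal.\<close>

lemma latin_distinct_slice:
  assumes f: "latin (insert r T) f" and g: "latin (insert r T) g" and h: "latin (insert r T) h"
    and eq0: "\<And>x. x \<in> points T \<Longrightarrow> f x = g x \<and> f x = h x" and r: "r \<notin> T"
    and fg: "\<exists>x\<in>points (insert r T). f x \<noteq> g x"
    and fh: "\<exists>x\<in>points (insert r T). f x \<noteq> h x"
    and gh: "\<exists>x\<in>points (insert r T). g x \<noteq> h x"
  shows "\<exists>c. c \<noteq> 0 \<and> (\<exists>x\<in>points T. f (x(r := c)) \<noteq> g (x(r := c))) \<and>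
    (\<exists>x\<in>points T. f (x(r := c)) \<noteq> h (x(r := c))) \<and> (\<exists>x\<in>points T. g (x(r := c)) \<noteq> h (x(r := c)))"
proof (rule ccontr)
  define E where "E p q c \<longleftrightarrow> (\<forall>x\<in>points T. p (x(r := c)) = q (x(r := c)))"
    for p q :: "('a \<Rightarrow> klein) \<Rightarrow> klein" and c
  assume "\<not> ?thesis"
  then have some: "E f g c \<or> E f h c \<or> E g h c" if "c \<noteq> 0" for c using that by (auto simp: E_def)
  have zero_r: "x(r := 0) = x" if "x \<in> points T" for x :: "'a \<Rightarrow> klein"
    using that r by (auto simp: points_def)
  have E0: "E f g 0" "E f h 0" "E g h 0" using eq0 by (fastforce simp: E_def zero_r)+
  have E_sym: "E p q c \<Longrightarrow> E q p c" for p q c by (simp add: E_def)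
  have eq_pts: "p x = q x" if p: "latin (insert r T) p" and q: "latin (insert r T) q"
    and E: "E p q 0" "E p q c" "E p q d" "0 \<noteq> c" "0 \<noteq> d" "c \<noteq> d" "x \<in> points (insert r T)" for p q c d x
  proof -
    have y: "x(r := 0) \<in> points T" using that(9) by (rule points_remove_upd)
    have "p ((x(r := 0))(r := x r)) = q ((x(r := 0))(r := x r))"
      by (rule latin_third_slice[OF p q y, of 0 c d]) (use E y in \<open>auto simp: E_def simp del: fun_upd_upd\<close>)
    then show ?thesis by simp
  qed
  have two: "\<not> (E f g c \<and> E f g d)" "\<not> (E f h c \<and> E f h d)" "\<not> (E g h c \<and> E g h d)"
    if "0 \<noteq> c" "0 \<noteq> d" "c \<noteq> d" for c d
    using eq_pts[OF f g E0(1) _ _ that] eq_pts[OF f h E0(2) _ _ that] eq_pts[OF g h E0(3) _ _ that] fg fh gh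
    by blast+
  have tri: "\<not> (E f g c1 \<and> E f h c2 \<and> E g h c3)"
    if ne: "distinct [0, c1, c2, c3]" for c1 c2 c3
  proof
    assume E: "E f g c1 \<and> E f h c2 \<and> E g h c3"
    \<comment> \<open>The value of \<open>f\<close> at \<open>c2\<close> differs from those of
      \<open>g\<close> at 0, \<open>c1\<close> and \<open>c3\<close>: the first two are also values
      of \<open>f\<close>, and the third is a value of \<open>h\<close>, which agrees with
      \<open>f\<close> at \<open>c2\<close>.\<close>
    have "E f g c2" unfolding E_def
    proof
      fix x assume x: "x \<in> points T"
      then have x': "x \<in> points (insert r T)" by (auto simp: points_def)
      note nf = latin_neq[OF f x', of r] and ng = latin_neq[OF g x', of r] and nh = latin_neq[OF h x', of r]
      have eqs: "f (x(r := c1)) = g (x(r := c1))" "f (x(r := c2)) = h (x(r := c2))"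
        "g (x(r := c3)) = h (x(r := c3))" "f (x(r := 0)) = g (x(r := 0))"
        using E E0 x by (auto simp: E_def)
      show "f (x(r := c2)) = g (x(r := c2))"
      proof (rule klein_four[of "g (x(r := 0))" "g (x(r := c1))" "g (x(r := c3))"])
        show "distinct [g (x(r := 0)), g (x(r := c1)), g (x(r := c3))]" using ng ne by auto
        show "g (x(r := c2)) \<notin> {g (x(r := 0)), g (x(r := c1)), g (x(r := c3))}" using ng ne by auto
        have "f (x(r := c2)) \<noteq> g (x(r := 0))" using nf[of c2 0] ne eqs by auto
        moreover have "f (x(r := c2)) \<noteq> g (x(r := c1))" using nf[of c2 c1] ne eqs by auto
        moreover have "f (x(r := c2)) \<noteq> g (x(r := c3))" using nh[of c2 c3] ne eqs by auto
        ultimately show "f (x(r := c2)) \<notin> {g (x(r := 0)), g (x(r := c1)), g (x(r := c3))}" by simp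
      qed
    qed
    with two(1)[of c1 c2] E ne show False by auto
  qed
  have perms: "distinct [0, K1, K2, K3]" "distinct [0, K1, K3, K2]" "distinct [0, K2, K1, K3]"
    "distinct [0, K2, K3, K1]" "distinct [0, K3, K1, K2]" "distinct [0, K3, K2, K1]"
    by (simp_all add: zero_klein_def)
  have nz: "0 \<noteq> K1" "0 \<noteq> K2" "0 \<noteq> K3" "K1 \<noteq> K2" "K1 \<noteq> K3" "K2 \<noteq> K3" by (simp_all add: zero_klein_def)
  show False
    using some[OF nz(1)[symmetric]] some[OF nz(2)[symmetric]] some[OF nz(3)[symmetric]]
      two[OF nz(1,2,4)] two[OF nz(1,3,5)] two[OF nz(2,3,6)]
      tri[OF perms(1)] tri[OF perms(2)] tri[OF perms(3)] tri[OF perms(4)] tri[OF perms(5)] tri[OF perms(6)]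
    by argo
qed

section \<open>Three completions force an affine boundary\<close>

lemma card_ge_2_other:
  assumes "card S \<ge> 2"
  shows "\<exists>j\<in>S. j \<noteq> i"
proof (rule ccontr)
  assume "\<not> ?thesis"
  then have "S \<subseteq> {i}" by auto
  then have "card S \<le> 1" using card_mono[of "{i}" S] by simp
  with assms show False by simp
qed

section \<open>Relabelling of symbols and affine functions\<close>

definition zero_bij :: "('i \<Rightarrow> klein \<Rightarrow> klein) \<Rightarrow> bool" where
  "zero_bij p \<longleftrightarrow> (\<forall>i. bij (p i) \<and> p i 0 = 0)"

definition relabel :: "('i \<Rightarrow> klein \<Rightarrow> klein) \<Rightarrow> ('i \<Rightarrow> klein) \<Rightarrow> 'i \<Rightarrow> klein" where
  "relabel p x = (\<lambda>i. p i (x i))"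

text \<open>Permutations fixing 0 are exactly the automorphisms of the Klein four-group, so
  \<open>zero_bij\<close> makes each \<open>p i\<close> linear although it mentions no
  addition.\<close>

definition klein_affine :: "'i set \<Rightarrow> (('i \<Rightarrow> klein) \<Rightarrow> klein) \<Rightarrow> bool" where
  "klein_affine S f \<longleftrightarrow> (\<exists>u p. zero_bij p \<and> (\<forall>x\<in>points S. f x = u + sum (relabel p x) S))"

lemma zero_bij_eq_0_iff: "zero_bij p \<Longrightarrow> p i v = 0 \<longleftrightarrow> v = 0"
  unfolding zero_bij_def by (metis bij_pointE)

lemma zero_bij_inv:
  assumes "zero_bij p" shows "zero_bij (\<lambda>i. inv (p i))"
  using assms unfolding zero_bij_def by (metis bij_imp_bij_inv bij_is_inj inv_f_eq)

lemma relabel_inv [simp]: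
  assumes "zero_bij p"
  shows "relabel p (relabel (\<lambda>i. inv (p i)) x) = x" "relabel (\<lambda>i. inv (p i)) (relabel p x) = x"
  using assms by (auto simp: relabel_def zero_bij_def bij_is_surj surj_f_inv_f bij_is_inj)

lemma relabel_points: "zero_bij p \<Longrightarrow> relabel p x \<in> points S \<longleftrightarrow> x \<in> points S"
  by (auto simp: points_def relabel_def zero_bij_eq_0_iff)

lemma relabel_boundary: "zero_bij p \<Longrightarrow> relabel p x \<in> boundary S \<longleftrightarrow> x \<in> boundary S"
  by (simp add: boundary_def relabel_points) (auto simp: relabel_def zero_bij_eq_0_iff)

lemma relabel_upd: "relabel p (x(i := v)) = (relabel p x)(i := p i v)"
  by (auto simp: relabel_def)

lemma latin_relabel:
  assumes "latin S f" "zero_bij p"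
  shows "latin S (\<lambda>x. u + f (relabel p x))"
  unfolding latin_def
proof (intro ballI injI)
  fix x i v w
  assume "x \<in> points S" "i \<in> S" "u + f (relabel p (x(i := v))) = u + f (relabel p (x(i := w)))"
  then have "p i v = p i w"
    using latin_neq[OF assms(1), of "relabel p x" i "p i v" "p i w"] assms(2)
    by (auto simp: relabel_upd relabel_points)
  then show "v = w" using assms(2) unfolding zero_bij_def by (metis bij_pointE)
qed

lemma latin_sum_relabel:
  assumes "finite S" "zero_bij p"
  shows "latin S (\<lambda>x. u + sum (relabel p x) S)"
proof -
  have "latin S (\<lambda>x. sum x S)"
    unfolding latin_def using assms(1) by (auto simp: inj_def sum_upd simp del: fun_upd_apply)
  from latin_relabel[OF this assms(2)] show ?thesis .
qed

theorem latin_eq_affine_flip: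
  assumes "finite S" and two: "\<And>i. i \<in> S \<Longrightarrow> \<exists>j\<in>S. j \<noteq> i"
    and f: "latin S f" and p: "zero_bij p"
    and bd: "\<And>x. x \<in> boundary S \<Longrightarrow> f x = u + sum (relabel p x) S"
  shows "\<exists>e. \<forall>x\<in>points S. f x = u + flip_sum S e (relabel p x)"
proof -
  let ?q = "\<lambda>i. inv (p i)"
  have q: "zero_bij ?q" using p by (rule zero_bij_inv)
  have "\<exists>e. \<forall>x\<in>points S. u + f (relabel ?q x) = flip_sum S e x"
  proof (rule latin_eq_flip_sum[OF assms(1) two latin_relabel[OF f q]])
    fix x assume "x \<in> boundary S"
    then show "u + f (relabel ?q x) = sum x S" using bd[of "relabel ?q x"] p q by (simp add: relabel_boundary)
  qed
  then obtain e where e: "\<And>x. x \<in> points S \<Longrightarrow> u + f (relabel ?q x) = flip_sum S e x" by auto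
  have "f x = u + flip_sum S e (relabel p x)" if "x \<in> points S" for x
    using e[of "relabel p x"] that p by (simp add: relabel_points flip: e)
  then show ?thesis by blast
qed

text \<open>A line of \<open>f\<close> through a point with \<open>x i = 0\<close>, shifted to fix
  0, is an admissible relabelling; in this way a component of the affine form is read off from
  \<open>f\<close>.\<close>

lemma zero_bij_line:
  assumes "latin S f" "x \<in> points S" "i \<in> S" "zero_bij p" and "x i = 0"
  shows "zero_bij (p(i := (\<lambda>v. f (x(i := v)) + f x)))"
proof -
  have "inj (\<lambda>v. f (x(i := v)) + f x)"
    using assms(1-3) by (auto simp: latin_def inj_def)
  then have "bij (\<lambda>v. f (x(i := v)) + f x)" by (simp add: bij_def finite_UNIV_inj_surj)
  moreover have "x(i := 0) = x" using assms(5) by auto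
  ultimately show ?thesis using assms(4) by (auto simp: zero_bij_def)
qed

text \<open>Induction on the dimension: a slice in which the three completions differ has an affine
  boundary, so after relabelling all three are flip sums there, and
  \<open>affine_boundary_step\<close> extends the affine form to the boundary of the whole
  cube.\<close>

theorem three_completions_affine:
  assumes "finite S" "card S \<ge> 2" "latin S f" "latin S g" "latin S h"
    and "\<And>x. x \<in> boundary S \<Longrightarrow> g x = f x" "\<And>x. x \<in> boundary S \<Longrightarrow> h x = f x"
    and "\<exists>x\<in>points S. f x \<noteq> g x" "\<exists>x\<in>points S. f x \<noteq> h x" "\<exists>x\<in>points S. g x \<noteq> h x"
  shows "\<exists>u p. zero_bij p \<and> (\<forall>x\<in>boundary S. f x = u + sum (relabel p x) S)"
  using assms
proof (induction S arbitrary: f g h rule: finite_induct)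
  case empty
  then show ?case by simp
next
  case (insert r T)
  let ?S = "insert r T"
  note f = insert.prems(2) and g = insert.prems(3) and h = insert.prems(4)
  have o: "(\<lambda>_. 0) \<in> points A" for A :: "'a set" by (simp add: points_def)
  show ?case
  proof (cases "card T \<ge> 2")
    case False
    then have "card T = 1" using insert.prems(1) insert.hyps by simp
    then obtain t where T: "T = {t}" by (auto simp: card_1_singleton_iff)
    have rt: "r \<noteq> t" using insert.hyps T by auto
    \<comment> \<open>In dimension two the boundary consists of two axes, where any Latin values are
      of affine form.\<close>
    define p where "p = ((\<lambda>i v. v)(r := (\<lambda>v. f ((\<lambda>_. 0)(r := v)) + f (\<lambda>_. 0))))
      (t := (\<lambda>v. f ((\<lambda>_. 0)(t := v)) + f (\<lambda>_. 0)))"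
    have "zero_bij (\<lambda>(i::'a) v. v)" by (auto simp: zero_bij_def bij_def inj_def)
    then have "zero_bij p" unfolding p_def
      using T by (intro zero_bij_line[OF f o]) auto
    moreover have "f x = f (\<lambda>_. 0) + sum (relabel p x) ?S" if x: "x \<in> boundary ?S" for x
    proof -
      have "x = (\<lambda>_. 0)(t := x t) \<and> x r = 0 \<or> x = (\<lambda>_. 0)(r := x r) \<and> x t = 0"
        using x T by (auto simp: boundary_def points_def fun_eq_iff)
      then show ?thesis
      proof (elim disjE conjE)
        assume x: "x = (\<lambda>_. 0)(t := x t)" "x r = 0"
        have "(\<lambda>_. 0)(r := 0) = (\<lambda>_. (0::klein))" by auto
        with x rt have "sum (relabel p x) ?S = f ((\<lambda>_. 0)(t := x t)) + f (\<lambda>_. 0)"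
          by (simp add: T relabel_def p_def)
        with x(1) show ?thesis by (metis add.commute klein_add_self_left)
      next
        assume x: "x = (\<lambda>_. 0)(r := x r)" "x t = 0"
        have "(\<lambda>_. 0)(t := 0) = (\<lambda>_. (0::klein))" by auto
        with x rt have "sum (relabel p x) ?S = f ((\<lambda>_. 0)(r := x r)) + f (\<lambda>_. 0)"
          by (simp add: T relabel_def p_def)
        with x(1) show ?thesis by (metis add.commute klein_add_self_left)
      qed
    qed
    ultimately show ?thesis by blast
  next
    case True
    then have ne: "T \<noteq> {}" by auto
    have bT: "x(r := c) \<in> boundary ?S" if "x \<in> boundary T" for x c
      using that insert.hyps(2) by (auto simp: boundary_def points_def)
    have b0: "x \<in> boundary ?S" if "x \<in> points T" for x
      using that insert.hyps(2) by (auto simp: boundary_def points_def)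
    obtain c where c: "c \<noteq> 0"
      and dist: "\<exists>x\<in>points T. f (x(r := c)) \<noteq> g (x(r := c))"
        "\<exists>x\<in>points T. f (x(r := c)) \<noteq> h (x(r := c))" "\<exists>x\<in>points T. g (x(r := c)) \<noteq> h (x(r := c))"
      using latin_distinct_slice[OF f g h _ insert.hyps(2) insert.prems(7-9)] insert.prems(5,6) b0
      by metis
    have "\<exists>u p. zero_bij p \<and> (\<forall>x\<in>boundary T. f (x(r := c)) = u + sum (relabel p x) T)"
      by (rule insert.IH[OF True latin_slice[OF f insert.hyps(2)] latin_slice[OF g insert.hyps(2)]
            latin_slice[OF h insert.hyps(2)] _ _ dist])
         (use insert.prems(5,6) bT in blast)+
    then obtain u p0 where p0: "zero_bij p0"
      and fc0: "\<And>x. x \<in> boundary T \<Longrightarrow> f (x(r := c)) = u + sum (relabel p0 x) T" by blast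
    \<comment> \<open>Coordinate \<open>r\<close> is left alone so that slice \<open>c\<close> stays
      slice \<open>c\<close>.\<close>
    define p where "p = p0(r := (\<lambda>v. v))"
    have p: "zero_bij p" using p0 by (auto simp: zero_bij_def p_def bij_def inj_def)
    have "sum (relabel p x) T = sum (relabel p0 x) T" for x
      using insert.hyps(2) by (auto simp: relabel_def p_def intro!: sum.cong)
    with fc0 have fc: "f (x(r := c)) = u + sum (relabel p x) T" if "x \<in> boundary T" for x using that by simp
    let ?q = "\<lambda>i. inv (p i)"
    have q: "zero_bij ?q" using p by (rule zero_bij_inv)
    have "inv (\<lambda>v::klein. v) = (\<lambda>v. v)" using inv_id by (simp add: id_def)
    then have q_r: "relabel ?q (x(r := v)) = (relabel ?q x)(r := v)"
      and p_r: "relabel p (x(r := v)) = (relabel p x)(r := v)" for x v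
      by (simp_all add: relabel_upd p_def)
    \<comment> \<open>\<open>F\<close> turns the affine boundary of slice \<open>c\<close> into the
      plain sum, so that \<open>latin_eq_flip_sum\<close> applies.\<close>
    define F where "F k x = u + k (relabel ?q x)" for k :: "('a \<Rightarrow> klein) \<Rightarrow> klein" and x
    have F_latin: "latin ?S (F k)" if "latin ?S k" for k
      unfolding F_def using latin_relabel[OF that q] by simp
    have k_F: "k x = u + F k (relabel p x)" for k x using p by (simp add: F_def)
    have flip: "\<exists>e. \<forall>x\<in>points T. F k (x(r := c)) = flip_sum T e x"
      if k: "latin ?S k" "\<And>x. x \<in> boundary ?S \<Longrightarrow> k x = f x" for k
    proof (rule latin_eq_flip_sum[OF insert.hyps(1) card_ge_2_other[OF True] latin_slice[OF F_latin[OF k(1)] insert.hyps(2)]])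
      fix x assume x: "x \<in> boundary T"
      then have x': "relabel ?q x \<in> boundary T" using q by (simp add: relabel_boundary)
      have "k ((relabel ?q x)(r := c)) = f ((relabel ?q x)(r := c))" by (rule k(2)[OF bT[OF x']])
      also have "\<dots> = u + sum x T" using fc[OF x'] p by simp
      finally show "F k (x(r := c)) = sum x T" by (simp add: F_def q_r)
    qed
    obtain ef eg eh where ef: "\<And>x. x \<in> points T \<Longrightarrow> F f (x(r := c)) = flip_sum T ef x"
      and eg: "\<And>x. x \<in> points T \<Longrightarrow> F g (x(r := c)) = flip_sum T eg x"
      and eh: "\<And>x. x \<in> points T \<Longrightarrow> F h (x(r := c)) = flip_sum T eh x"
      using flip[OF f] flip[OF g] flip[OF h] insert.prems(5,6) by blast
    have ne_e: "e1 \<noteq> e2" if "\<exists>x\<in>points T. k (x(r := c)) \<noteq> l (x(r := c))"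
      and "\<And>x. x \<in> points T \<Longrightarrow> F k (x(r := c)) = flip_sum T e1 x"
      and "\<And>x. x \<in> points T \<Longrightarrow> F l (x(r := c)) = flip_sum T e2 x" for k l e1 e2
    proof
      assume "e1 = e2"
      from that(1) obtain x where x: "x \<in> points T" "k (x(r := c)) \<noteq> l (x(r := c))" by auto
      have "relabel p x \<in> points T" using x(1) p by (simp add: relabel_points)
      then have "F k (relabel p (x(r := c))) = F l (relabel p (x(r := c)))"
        using that(2,3)[of "relabel p x"] \<open>e1 = e2\<close> by (simp add: p_r)
      with k_F[of k] k_F[of l] x(2) show False by metis
    qed
    have es: "ef \<noteq> eg" "ef \<noteq> eh" "eg \<noteq> eh"
      using ne_e[OF dist(1) ef eg] ne_e[OF dist(2) ef eh] ne_e[OF dist(3) eg eh] by auto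
    have F_bd: "F k x = F f x" if "\<And>x. x \<in> boundary ?S \<Longrightarrow> k x = f x" "x \<in> boundary ?S" for k x
      using that(1)[of "relabel ?q x"] that(2) q by (simp add: F_def relabel_boundary)
    \<comment> \<open>Of three distinct flip parameters at most one is 0, so the roles
      \<open>k\<close> and \<open>l\<close> can go to completions with nonzero parameters. The
      boundary being common, the result for \<open>k\<close> is one for \<open>f\<close>.\<close>
    have key: "F f x = sum x T + F f ((\<lambda>_. 0)(r := x r))"
      if k: "latin ?S k" "\<And>x. x \<in> boundary ?S \<Longrightarrow> k x = f x"
        and l: "latin ?S l" "\<And>x. x \<in> boundary ?S \<Longrightarrow> l x = f x"
        and m: "latin ?S m" "\<And>x. x \<in> boundary ?S \<Longrightarrow> m x = f x"
        and ek: "\<And>x. x \<in> points T \<Longrightarrow> F k (x(r := c)) = flip_sum T ek x" "ek \<noteq> 0"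
        and el: "\<And>x. x \<in> points T \<Longrightarrow> F l (x(r := c)) = flip_sum T el x" "el \<noteq> 0"
        and em: "\<And>x. x \<in> points T \<Longrightarrow> F m (x(r := c)) = flip_sum T em x"
        and e_ne: "ek \<noteq> el" "em \<noteq> ek" "em \<noteq> el" and x: "x \<in> boundary ?S"
      for k l m ek el em x
    proof -
      have ne_slice: "F k x \<noteq> F n (x(r := c))"
        if n: "latin ?S n" "\<And>x. x \<in> boundary ?S \<Longrightarrow> n x = f x" and x: "x \<in> points T" for n x
      proof -
        have "F k x = F n x" using F_bd[OF k(2)] F_bd[OF n(2)] b0[OF x] by metis
        moreover have "x r \<noteq> c" using x insert.hyps(2) c by (auto simp: points_def)
        then have "F n x \<noteq> F n (x(r := c))"
          using latin_neq_upd[OF F_latin[OF n(1)], of x r c] x points_mono[of T ?S] by auto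
        ultimately show ?thesis by simp
      qed
      have "F k x = sum x T + F k ((\<lambda>_. 0)(r := x r))"
      proof (rule affine_boundary_step[OF insert.hyps(1) ne insert.hyps(2) F_latin[OF k(1)] c ek(2) el(2) e_ne(1) ek(1)])
        show "F k x \<noteq> flip_sum T el x" if "x \<in> points T" for x
          using ne_slice[OF l that] el(1)[OF that] by simp
        show "F k x \<noteq> flip_sum T em x" if "x \<in> points T" for x
          using ne_slice[OF m that] em(1)[OF that] by simp
      qed (use e_ne x in auto)
      moreover have "(\<lambda>_. 0)(r := x r) \<in> boundary ?S"
        using ne insert.hyps(2) by (auto simp: boundary_def points_def)
      ultimately show ?thesis using F_bd[OF k(2)] x by metis
    qed
    have Ff: "F f x = sum x T + F f ((\<lambda>_. 0)(r := x r))" if x: "x \<in> boundary ?S" for x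
    proof -
      note G = g insert.prems(5) and H = h insert.prems(6)
      consider "ef = 0" | "eg = 0" | "ef \<noteq> 0" "eg \<noteq> 0" by blast
      then show ?thesis
      proof cases
        case 1
        then show ?thesis using key[OF G H f refl eg _ eh _ ef _ _ _ x] es by auto
      next
        case 2
        then show ?thesis using key[OF f refl H G ef _ eh _ eg _ _ _ x] es by auto
      next
        case 3
        then show ?thesis using key[OF f refl G H ef _ eg _ eh _ _ _ x] es by auto
      qed
    qed
    define p' where "p' = p(r := (\<lambda>v. F f ((\<lambda>_. 0)(r := v)) + F f (\<lambda>_. 0)))"
    have "zero_bij p'" unfolding p'_def
      by (rule zero_bij_line[OF F_latin[OF f] o _ p]) auto
    moreover have "f x = (u + F f (\<lambda>_. 0)) + sum (relabel p' x) ?S" if x: "x \<in> boundary ?S" for x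
    proof -
      have "relabel p x \<in> boundary ?S" using x p by (simp add: relabel_boundary)
      moreover have "relabel p x r = x r" by (simp add: relabel_def p_def)
      ultimately have "f x = u + (sum (relabel p x) T + F f ((\<lambda>_. 0)(r := x r)))"
        using Ff k_F[of f x] by simp
      moreover have "sum (relabel p' x) T = sum (relabel p x) T"
        using insert.hyps(2) by (auto simp: relabel_def p'_def intro!: sum.cong)
      moreover have "relabel p' x r = F f ((\<lambda>_. 0)(r := x r)) + F f (\<lambda>_. 0)"
        by (simp add: relabel_def p'_def)
      ultimately have "f x = u + (sum (relabel p' x) T + F f ((\<lambda>_. 0)(r := x r)))"
        "sum (relabel p' x) ?S = F f ((\<lambda>_. 0)(r := x r)) + F f (\<lambda>_. 0) + sum (relabel p' x) T"
        using insert.hyps by simp_all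
      then show ?thesis by (simp add: ac_simps)
    qed
    ultimately show ?thesis by blast
  qed
qed

section \<open>Codes on the subset lattice\<close>

text \<open>A code records for every coordinate set the index of the completion chosen there (\<open>0\<close> if it is
  affine); above a set with a non-affine choice only two indices are left.\<close>

definition codes :: "'a set set \<Rightarrow> ('a set \<Rightarrow> klein) set" where
  "codes A = {c \<in> A \<rightarrow>\<^sub>E UNIV. \<forall>S\<in>A. \<forall>T\<in>A. T \<subset> S \<longrightarrow> c T \<noteq> 0 \<longrightarrow> c S \<in> {0, K1}}"

lemma finite_codes: "finite A \<Longrightarrow> finite (codes A)"
  by (rule finite_subset[of _ "A \<rightarrow>\<^sub>E UNIV"]) (auto simp: codes_def intro: finite_PiE)

lemma codes_empty [simp]: "codes {} = {\<lambda>_. undefined}"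
  by (auto simp: codes_def)

lemma restrict_codes: "c \<in> codes A \<Longrightarrow> B \<subseteq> A \<Longrightarrow> restrict c B \<in> codes B"
  unfolding codes_def by simp blast

text \<open>The constraints between the two families are dropped; those within each chain are all
  that the final count uses.\<close>

lemma card_codes_Un:
  assumes "finite A" "finite B"
  shows "card (codes (A \<union> B)) \<le> card (codes A) * card (codes B)"
proof -
  have "inj_on (\<lambda>c. (restrict c A, restrict c B)) (codes (A \<union> B))"
  proof (rule inj_onI)
    fix c d assume "c \<in> codes (A \<union> B)" "d \<in> codes (A \<union> B)"
      and eq: "(restrict c A, restrict c B) = (restrict d A, restrict d B)"
    then have "c \<in> extensional (A \<union> B)" "d \<in> extensional (A \<union> B)" by (auto simp: codes_def PiE_def)
    moreover have "c x = d x" if "x \<in> A \<union> B" for x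
      using eq that by (metis Pair_inject Un_iff restrict_apply')
    ultimately show "c = d" by (rule extensionalityI)
  qed
  moreover have "(\<lambda>c. (restrict c A, restrict c B)) ` codes (A \<union> B) \<subseteq> codes A \<times> codes B"
    using restrict_codes by blast
  ultimately have "card (codes (A \<union> B)) \<le> card (codes A \<times> codes B)"
    using assms by (intro card_inj_on_le) (auto simp: finite_codes)
  then show ?thesis by (simp add: card_cartesian_product)
qed

lemma sorted_psubset_distinct: "sorted_wrt (\<subset>) Us \<Longrightarrow> distinct Us"
  by (induction Us) auto

text \<open>At the bottom set, index 0 leaves a code of the rest, while each of the three other
  indices leaves two choices at every set above. Each new bottom set thus adds at most 3 times a
  power of two, and the summand 2 closes this geometric sum exactly.\<close>

lemma card_codes_chain:
  assumes "sorted_wrt (\<subset>) Us"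
  shows "card (codes (set Us)) + 2 \<le> 3 * 2 ^ length Us"
  using assms
proof (induction Us)
  case Nil
  then show ?case by simp
next
  case (Cons U Us)
  let ?A = "codes (set (U # Us))"
  let ?B = "{0 :: klein} \<times> codes (set Us) \<union> (UNIV - {0}) \<times> (set Us \<rightarrow>\<^sub>E {0, K1})"
  let ?h = "\<lambda>c. (c U, restrict c (set Us))"
  have U: "U \<notin> set Us" "\<And>V. V \<in> set Us \<Longrightarrow> U \<subset> V" using Cons.prems by auto
  have "inj_on ?h ?A"
  proof (rule inj_onI)
    fix c d assume "c \<in> ?A" "d \<in> ?A" and eq: "?h c = ?h d"
    then have "c \<in> extensional (set (U # Us))" "d \<in> extensional (set (U # Us))"
      by (auto simp: codes_def PiE_def)
    moreover have "c x = d x" if "x \<in> set (U # Us)" for x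
      using eq that by (metis Pair_inject restrict_apply' set_ConsD)
    ultimately show "c = d" by (rule extensionalityI)
  qed
  moreover have "?h ` ?A \<subseteq> ?B"
  proof (intro image_subsetI)
    fix c assume c: "c \<in> ?A"
    show "?h c \<in> ?B"
    proof (cases "c U = 0")
      case True
      then show ?thesis using restrict_codes[OF c, of "set Us"] by auto
    next
      case False
      have "c V \<in> {0, K1}" if "V \<in> set Us" for V
        using c False U(2)[OF that] that by (auto simp: codes_def)
      with False show ?thesis by auto
    qed
  qed
  moreover have "finite ?B" by (intro finite_UnI finite_SigmaI finite_codes finite_PiE) auto
  ultimately have "card ?A \<le> card ?B" by (intro card_inj_on_le)
  also have "\<dots> \<le> card ({0 :: klein} \<times> codes (set Us)) + card ((UNIV - {0 :: klein}) \<times> (set Us \<rightarrow>\<^sub>E {0, K1}))"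
    by (rule card_Un_le)
  also have "card ((UNIV - {0 :: klein}) \<times> (set Us \<rightarrow>\<^sub>E {0, K1})) = 3 * 2 ^ length Us"
  proof -
    have "card (UNIV - {0 :: klein}) = 3" by (simp add: card_klein)
    moreover have "card {0, K1} = 2" by (simp add: zero_klein_def)
    moreover have "card (set Us) = length Us"
      using Cons.prems sorted_psubset_distinct[of Us] by (simp add: distinct_card)
    ultimately show ?thesis by (simp add: card_cartesian_product card_PiE)
  qed
  finally show ?case using Cons by (simp add: card_cartesian_product)
qed

text \<open>The number of chains in the symmetric chain decomposition of the product of a \<open>k\<close>-dimensional cube
  with a chain of length \<open>l\<close>.\<close>

fun chain_count :: "nat \<Rightarrow> nat \<Rightarrow> nat" where
  "chain_count 0 l = (if l = 0 then 0 else 1)"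
| "chain_count (Suc k) 0 = 0"
| "chain_count (Suc k) (Suc l) = chain_count k (Suc (Suc l)) + chain_count k l"

text \<open>The exponent of 2 counts sets, that of 3 counts chains. As in the decomposition of de
  Bruijn, Tengbergen and Kruyswijk, a new element splits the doubled chain of length l into chains
  of lengths l + 1 and l - 1.\<close>

lemma card_codes_grid:
  assumes "finite K" "sorted_wrt (\<subset>) Us" "\<And>U. U \<in> set Us \<Longrightarrow> U \<inter> K = {}"
  shows "card (codes {X \<union> U | X U. X \<subseteq> K \<and> U \<in> set Us})
    \<le> 2 ^ (length Us * 2 ^ card K) * 3 ^ chain_count (card K) (length Us)"
  using assms
proof (induction K arbitrary: Us rule: finite_induct)
  case empty
  have "{X \<union> U | X U. X \<subseteq> {} \<and> U \<in> set Us} = set Us" by auto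
  then show ?case using card_codes_chain[OF empty(1)] by (cases Us) auto
next
  case (insert a K)
  let ?A = "\<lambda>K Us. {X \<union> U | X U. X \<subseteq> K \<and> U \<in> set Us}"
  have fin: "finite (?A K Us)" for Us :: "'a set list"
  proof -
    have "?A K Us = (\<lambda>(X, U). X \<union> U) ` (Pow K \<times> set Us)" by auto
    then show ?thesis using insert.hyps(1) by simp
  qed
  show ?case
  proof (cases Us rule: rev_cases)
    case Nil
    then show ?thesis by simp
  next
    case (snoc Vs V)
    \<comment> \<open>One chain climbs through \<open>Us\<close> and adds \<open>a\<close> at the
      top; the other takes the remaining sets, those of \<open>Vs\<close> with \<open>a\<close>
      added.\<close>
    define Us' where "Us' = Us @ [insert a V]"
    define Us'' where "Us'' = map (insert a) Vs"
    have srt: "sorted_wrt (\<subset>) Vs" "\<And>U. U \<in> set Vs \<Longrightarrow> U \<subset> V"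
      using insert.prems(1) by (auto simp: snoc sorted_wrt_append)
    have a: "a \<notin> U" "U \<inter> K = {}" if "U \<in> set Us" for U using insert.prems(2)[OF that] by auto
    have s': "sorted_wrt (\<subset>) Us'"
      using insert.prems(1) srt(2) a(1)[of V] by (auto simp: Us'_def snoc sorted_wrt_append)
    have s'': "sorted_wrt (\<subset>) Us''"
      unfolding Us''_def sorted_wrt_map
    proof (rule sorted_wrt_mono_rel[OF _ srt(1)])
      fix U W assume "U \<in> set Vs" "W \<in> set Vs" "U \<subset> W"
      then show "insert a U \<subset> insert a W" using a(1)[of U] a(1)[of W] by (auto simp: snoc)
    qed
    have d': "U \<inter> K = {}" if "U \<in> set Us'" for U
      using that a insert.hyps(2) by (auto simp: Us'_def snoc)
    have d'': "U \<inter> K = {}" if "U \<in> set Us''" for U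
      using that a insert.hyps(2) by (fastforce simp: Us''_def snoc)
    have "?A (insert a K) Us \<subseteq> ?A K Us' \<union> ?A K Us''"
    proof
      fix Y assume "Y \<in> ?A (insert a K) Us"
      then obtain X U where Y: "Y = X \<union> U" "X \<subseteq> insert a K" "U \<in> set Us" by auto
      show "Y \<in> ?A K Us' \<union> ?A K Us''"
      proof (cases "a \<in> X")
        case False
        then have "X \<subseteq> K" using Y(2) by auto
        then show ?thesis using Y by (auto simp: Us'_def)
      next
        case True
        then have "Y = (X - {a}) \<union> insert a U" "X - {a} \<subseteq> K" using Y by auto
        moreover have "insert a U \<in> set Us' \<union> set Us''" using Y(3) by (auto simp: Us'_def Us''_def snoc)
        ultimately show ?thesis by blast
      qed
    qed
    moreover have "?A K Us' \<union> ?A K Us'' \<subseteq> ?A (insert a K) Us"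
    proof
      fix Y assume "Y \<in> ?A K Us' \<union> ?A K Us''"
      then obtain X U where Y: "Y = X \<union> U" "X \<subseteq> K" "U \<in> set Us' \<union> set Us''" by auto
      then consider "U \<in> set Us" | W where "W \<in> set Us" "U = insert a W"
        by (auto simp: Us'_def Us''_def snoc)
      then show "Y \<in> ?A (insert a K) Us"
      proof cases
        case 1
        then show ?thesis using Y by auto
      next
        case 2
        then have "Y = insert a X \<union> W" "insert a X \<subseteq> insert a K" using Y by auto
        with 2 show ?thesis by blast
      qed
    qed
    ultimately have "?A (insert a K) Us = ?A K Us' \<union> ?A K Us''" by (rule equalityI)
    then have "card (codes (?A (insert a K) Us)) \<le> card (codes (?A K Us')) * card (codes (?A K Us''))"
      using card_codes_Un[OF fin fin] by simp
    also have "\<dots> \<le> (2 ^ (length Us' * 2 ^ card K) * 3 ^ chain_count (card K) (length Us')) *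
      (2 ^ (length Us'' * 2 ^ card K) * 3 ^ chain_count (card K) (length Us''))"
      by (intro mult_mono insert.IH s' s'' d' d'') auto
    also have "\<dots> = 2 ^ ((length Us' + length Us'') * 2 ^ card K) *
      3 ^ (chain_count (card K) (length Us') + chain_count (card K) (length Us''))"
      by (simp add: power_add add_mult_distrib)
    also have "length Us' + length Us'' = 2 * length Us" by (simp add: Us'_def Us''_def snoc)
    also have "chain_count (card K) (length Us') + chain_count (card K) (length Us'') =
      chain_count (card (insert a K)) (length Us)"
      using insert.hyps by (simp add: Us'_def Us''_def snoc)
    finally show ?thesis using insert.hyps by (simp add: mult.assoc mult.left_commute)
  qed
qed

lemma card_codes_Pow:
  assumes "finite K"
  shows "card (codes (Pow K)) \<le> 2 ^ 2 ^ card K * 3 ^ chain_count (card K) 1"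
proof -
  have "{X \<union> U | X U. X \<subseteq> K \<and> U \<in> set [{}]} = Pow K" by auto
  then show ?thesis using card_codes_grid[OF assms, of "[{}]"] by simp
qed

text \<open>\<open>chain_count k l\<close> also counts the walks of k unit steps up or down from l
  that never reach 0, and each such walk has at most two extensions.\<close>

lemma chain_count_Suc_le: "chain_count (Suc k) l \<le> 2 * chain_count k l"
proof (induction k arbitrary: l)
  case 0
  then show ?case by (cases l) auto
next
  case (Suc k)
  show ?case
  proof (cases l)
    case (Suc j)
    then show ?thesis using Suc.IH[of "Suc (Suc j)"] Suc.IH[of j] by (simp del: chain_count.simps add: chain_count.simps(3)[of _ j])
  qed simp
qed

lemma chain_count_le: "chain_count k l \<le> 2 ^ k"
proof (induction k)
  case (Suc k)
  then show ?case using chain_count_Suc_le[of k l] by simp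
qed simp

text \<open>For fixed \<open>l\<close> the fractions \<open>chain_count k l / 2 ^ k\<close> decrease in \<open>k\<close>, and their limit is a
  bounded harmonic function of \<open>l\<close> that vanishes at \<open>0\<close>.\<close>

lemma chain_count_tendsto_0: "(\<lambda>k. real (chain_count k 1) / 2 ^ k) \<longlonglongrightarrow> 0"
proof -
  define p where "p l k = real (chain_count k l) / 2 ^ k" for l k
  have dec: "p l (Suc k) \<le> p l k" for l k
    using chain_count_Suc_le[of k l] unfolding p_def
    by (simp add: field_simps)
  have bds: "0 \<le> p l k" "p l k \<le> 1" for l k
  proof -
    show "0 \<le> p l k" by (simp add: p_def)
    have "real (chain_count k l) \<le> real (2 ^ k)" using chain_count_le[of k l] by (rule of_nat_mono)
    then show "p l k \<le> 1" by (simp add: p_def)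
  qed
  have "convergent (p l)" for l
    using dec bds by (intro Bseq_monoseq_convergent BseqI'[of _ 1] decseq_imp_monoseq decseq_SucI) auto
  then obtain L where L: "\<And>l. p l \<longlonglongrightarrow> L l" unfolding convergent_def by metis
  have L0: "L 0 = 0"
  proof -
    have "p 0 k = 0" for k by (cases k) (auto simp: p_def)
    then have "p 0 = (\<lambda>_. 0)" by auto
    then have "p 0 \<longlonglongrightarrow> 0" by simp
    then show ?thesis using L[of 0] LIMSEQ_unique by blast
  qed
  have harm: "L (Suc l) = (L (Suc (Suc l)) + L l) / 2" for l
  proof -
    have "(\<lambda>k. (p (Suc (Suc l)) k + p l k) / 2) \<longlonglongrightarrow> (L (Suc (Suc l)) + L l) / 2"
      by (intro tendsto_intros L) simp
    moreover have "(\<lambda>k. (p (Suc (Suc l)) k + p l k) / 2) = (\<lambda>k. p (Suc l) (Suc k))"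
      by (auto simp: p_def field_simps)
    moreover have "(\<lambda>k. p (Suc l) (Suc k)) \<longlonglongrightarrow> L (Suc l)" using L[of "Suc l"] by (rule LIMSEQ_Suc)
    ultimately show ?thesis using LIMSEQ_unique by fastforce
  qed
  \<comment> \<open>A harmonic sequence on the naturals with value 0 at 0 is linear, and boundedness
    then makes the slope \<open>L 1\<close> vanish.\<close>
  have lin: "L l = real l * L 1 \<and> L (Suc l) = real (Suc l) * L 1" for l
  proof (induction l)
    case (Suc l)
    then show ?case using harm[of l] by (simp add: field_simps)
  qed (simp add: L0)
  have L1: "L l \<le> 1" "0 \<le> L l" for l
    using LIMSEQ_le_const2[OF L] LIMSEQ_le_const[OF L] bds by blast+
  have "L 1 = 0"
  proof (rule ccontr)
    assume "L 1 \<noteq> 0"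
    with L1(2)[of 1] have "L 1 > 0" by simp
    then obtain n :: nat where "real n * L 1 > 1" using ex_less_of_nat_mult by blast
    with lin[of n] L1(1)[of n] show False by simp
  qed
  with L[of 1] show ?thesis by (simp add: p_def[abs_def])
qed

section \<open>Counting Latin hypercubes\<close>

definition completions :: "'i set \<Rightarrow> (('i \<Rightarrow> klein) \<Rightarrow> klein) \<Rightarrow> (('i \<Rightarrow> klein) \<Rightarrow> klein) set" where
  "completions S f = {restrict g (points S) | g. latin S g \<and> (\<forall>x\<in>boundary S. g x = f x)}"

lemma completions_cong:
  "(\<And>x. x \<in> boundary S \<Longrightarrow> f x = g x) \<Longrightarrow> completions S f = completions S g"
  unfolding completions_def by auto

lemma restrict_in_completions: "latin S f \<Longrightarrow> restrict f (points S) \<in> completions S f"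
  by (auto simp: completions_def)

lemma restrict_points_eq_iff:
  "restrict f (points S) = restrict g (points S) \<longleftrightarrow> (\<forall>x\<in>points S. f x = g x)"
  by (metis restrict_apply' restrict_ext)

lemma klein_affine_cong: "(\<And>x. x \<in> points S \<Longrightarrow> f x = g x) \<Longrightarrow> klein_affine S f \<longleftrightarrow> klein_affine S g"
  unfolding klein_affine_def by simp

text \<open>Coordinates outside \<open>T\<close> contribute \<open>p i 0 = 0\<close>. Applied in the
  contrapositive: non-affinity is inherited by larger faces.\<close>

lemma klein_affine_mono:
  assumes "klein_affine S f" "T \<subseteq> S" "finite S"
  shows "klein_affine T f"
proof -
  obtain u p where p: "zero_bij p" and f: "\<And>x. x \<in> points S \<Longrightarrow> f x = u + sum (relabel p x) S"
    using assms(1) by (auto simp: klein_affine_def)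
  have "f x = u + sum (relabel p x) T" if "x \<in> points T" for x
  proof -
    have "sum (relabel p x) S = sum (relabel p x) T"
      using assms(2,3) that p by (intro sum.mono_neutral_right) (auto simp: points_def relabel_def zero_bij_def)
    then show ?thesis using f points_mono[OF assms(2)] that by auto
  qed
  with p show ?thesis by (auto simp: klein_affine_def)
qed

text \<open>The constant and each \<open>p i\<close> are visible on the axes, which belong to the
  boundary from dimension two on; hence an affine completion is unique.\<close>

lemma affine_eq_on_points:
  assumes "finite S" "card S \<ge> 2" "klein_affine S f" "klein_affine S g"
    and eq: "\<And>x. x \<in> boundary S \<Longrightarrow> f x = g x" and x: "x \<in> points S"
  shows "f x = g x"
proof -
  obtain u p where p: "zero_bij p" and f: "\<And>x. x \<in> points S \<Longrightarrow> f x = u + sum (relabel p x) S"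
    using assms(3) by (auto simp: klein_affine_def)
  obtain v q where q: "zero_bij q" and g: "\<And>x. x \<in> points S \<Longrightarrow> g x = v + sum (relabel q x) S"
    using assms(4) by (auto simp: klein_affine_def)
  have axis: "sum (relabel p ((\<lambda>_. 0)(i := w))) S = p i w" if "i \<in> S" "zero_bij p" for i w and p :: "'a \<Rightarrow> klein \<Rightarrow> klein"
  proof -
    have "relabel p (\<lambda>_. 0) = (\<lambda>_. 0)" using that by (simp add: relabel_def zero_bij_def)
    then show ?thesis using that sum_upd[OF assms(1) that(1), of "\<lambda>_. 0"] by (simp add: relabel_upd)
  qed
  have bd: "(\<lambda>_. 0)(i := w) \<in> boundary S" if "i \<in> S" for i w
    using card_ge_2_other[OF assms(2), of i] that by (auto simp: boundary_def points_def)
  obtain i where i: "i \<in> S" using assms(2) by fastforce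
  have eqs: "u + p i w = v + q i w" if "i \<in> S" for i w
    using eq[OF bd[OF that]] f g bd[OF that] boundary_subset axis[OF that p] axis[OF that q]
    by (metis subsetD)
  have uv: "u = v" using eqs[OF i, of 0] p q by (simp add: zero_bij_def)
  have "p i w = q i w" if "i \<in> S" for i w using eqs[OF that, of w] uv by simp
  then have "sum (relabel p x) S = sum (relabel q x) S" by (intro sum.cong) (auto simp: relabel_def)
  then show ?thesis using f[OF x] g[OF x] uv by simp
qed

lemma ex_inj_on_two:
  assumes "\<not> (\<exists>a b c. a \<in> C \<and> b \<in> C \<and> c \<in> C \<and> a \<noteq> b \<and> a \<noteq> c \<and> b \<noteq> c)"
  shows "\<exists>e. inj_on e C \<and> e ` C \<subseteq> {0, K1}"
proof (cases "C = {}")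
  case False
  then obtain a where a: "a \<in> C" by blast
  have "inj_on (\<lambda>g. if g = a then 0 else K1) C"
  proof (rule inj_onI)
    fix g h assume "g \<in> C" "h \<in> C" "(if g = a then 0 else K1) = (if h = a then 0 else K1)"
    with assms a show "g = h" by (metis klein.distinct(1) zero_klein_def)
  qed
  then show ?thesis by (intro exI[of _ "\<lambda>g. if g = a then 0 else K1"]) auto
qed simp

text \<open>The index \<open>0\<close> is reserved for the affine completion.\<close>

definition good_index :: "'i set \<Rightarrow> (('i \<Rightarrow> klein) \<Rightarrow> klein) set \<Rightarrow> ((('i \<Rightarrow> klein) \<Rightarrow> klein) \<Rightarrow> klein) \<Rightarrow> bool" where
  "good_index S C e \<longleftrightarrow> inj_on e C \<and> (\<forall>g\<in>C. klein_affine S g \<longrightarrow> e g = 0) \<and>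
     ((\<forall>g\<in>C. \<not> klein_affine S g) \<longrightarrow> e ` C \<subseteq> {0, K1})"

text \<open>With an affine completion present, the flip parameter relative to it serves as the
  index. With none, there are at most two completions: three would make the boundary affine, and its
  affine extension would be a completion.\<close>

lemma ex_good_index:
  assumes "finite S" "card S \<ge> 2"
  shows "\<exists>e. good_index S (completions S f) e"
proof (cases "\<exists>g\<in>completions S f. klein_affine S g")
  case True
  then obtain g0 where g0: "latin S g0" "\<And>x. x \<in> boundary S \<Longrightarrow> g0 x = f x"
    "klein_affine S (restrict g0 (points S))" by (auto simp: completions_def)
  then have "klein_affine S g0" using klein_affine_cong[of S "restrict g0 (points S)" g0] by simp
  then obtain u p where p: "zero_bij p" and g0_eq: "\<And>x. x \<in> points S \<Longrightarrow> g0 x = u + sum (relabel p x) S"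
    by (auto simp: klein_affine_def)
  have ex: "\<exists>e. \<forall>x\<in>points S. g x = u + flip_sum S e (relabel p x)"
    if g: "g \<in> completions S f" for g
  proof -
    obtain g' where g': "g = restrict g' (points S)" "latin S g'" "\<And>x. x \<in> boundary S \<Longrightarrow> g' x = f x"
      using g by (auto simp: completions_def)
    have "\<exists>e. \<forall>x\<in>points S. g' x = u + flip_sum S e (relabel p x)"
    proof (rule latin_eq_affine_flip[OF assms(1) _ g'(2) p])
      show "\<exists>j\<in>S. j \<noteq> i" for i using card_ge_2_other[OF assms(2)] .
      show "g' x = u + sum (relabel p x) S" if "x \<in> boundary S" for x
        using g'(3)[OF that] g0(2)[OF that] g0_eq[of x] that boundary_subset by auto
    qed
    then show ?thesis using g'(1) by simp
  qed
  define e where "e g = (SOME e. \<forall>x\<in>points S. g x = u + flip_sum S e (relabel p x))" for g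
  have e: "g x = u + flip_sum S (e g) (relabel p x)" if "g \<in> completions S f" "x \<in> points S" for g x
    using someI_ex[OF ex[OF that(1)]] that(2) unfolding e_def by blast
  have "inj_on e (completions S f)"
  proof (rule inj_onI)
    fix g h assume g: "g \<in> completions S f" and h: "h \<in> completions S f" and "e g = e h"
    then have "g x = h x" if "x \<in> points S" for x using e that by metis
    moreover have "g \<in> extensional (points S)" "h \<in> extensional (points S)"
      using g h by (auto simp: completions_def)
    ultimately show "g = h" by (intro extensionalityI)
  qed
  moreover have "e g = 0" if g: "g \<in> completions S f" "klein_affine S g" for g
  proof (rule ccontr)
    assume nz: "e g \<noteq> 0"
    \<comment> \<open>The point whose relabelled coordinates all equal \<open>b\<close> lies in the
      box of \<open>e g\<close>, where a nonzero parameter contradicts uniqueness of the affine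
      completion.\<close>
    obtain b where b: "b \<noteq> 0" "b \<noteq> e g"
    proof (cases "e g = K1")
      case True
      then show ?thesis by (intro that[of K2]) (auto simp: zero_klein_def)
    next
      case False
      then show ?thesis by (intro that[of K1]) (auto simp: zero_klein_def)
    qed
    define y where "y i = (if i \<in> S then b else 0)" for i
    define x where "x = relabel (\<lambda>i. inv (p i)) y"
    have y: "y \<in> points S" by (simp add: y_def points_def)
    then have x: "x \<in> points S" by (simp add: x_def relabel_points zero_bij_inv p)
    have xy: "relabel p x = y" using p by (simp add: x_def)
    have bd: "g x = g0 x" if "x \<in> boundary S" for x
      using g(1) g0(2)[OF that] that boundary_subset by (fastforce simp: completions_def)
    have "g x = g0 x"
      by (rule affine_eq_on_points[OF assms g(2) \<open>klein_affine S g0\<close> bd x])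
    then have "flip_sum S (e g) y = sum y S" using e[OF g(1) x] g0_eq[OF x] xy by simp
    moreover have "flip_box S (e g) y" using b by (simp add: flip_box_def y_def)
    ultimately show False using nz by (simp add: flip_sum_def)
  qed
  ultimately show ?thesis using True by (auto simp: good_index_def)
next
  case False
  let ?C = "completions S f"
  have "\<not> (\<exists>a b c. a \<in> ?C \<and> b \<in> ?C \<and> c \<in> ?C \<and> a \<noteq> b \<and> a \<noteq> c \<and> b \<noteq> c)"
  proof (intro notI, elim exE conjE)
    fix a b c assume C: "a \<in> ?C" "b \<in> ?C" "c \<in> ?C" and ne: "a \<noteq> b" "a \<noteq> c" "b \<noteq> c"
    from C obtain a' b' c' where abc: "a = restrict a' (points S)" "b = restrict b' (points S)"
        "c = restrict c' (points S)"
      and l: "latin S a'" "latin S b'" "latin S c'"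
      and bd: "\<And>x. x \<in> boundary S \<Longrightarrow> a' x = f x" "\<And>x. x \<in> boundary S \<Longrightarrow> b' x = f x"
        "\<And>x. x \<in> boundary S \<Longrightarrow> c' x = f x"
      unfolding completions_def by blast
    have "\<exists>u p. zero_bij p \<and> (\<forall>x\<in>boundary S. a' x = u + sum (relabel p x) S)"
      by (rule three_completions_affine[OF assms l]) (use bd ne abc in \<open>auto simp: restrict_points_eq_iff\<close>)
    then obtain u p where p: "zero_bij p" "\<And>x. x \<in> boundary S \<Longrightarrow> a' x = u + sum (relabel p x) S" by blast
    let ?g = "\<lambda>x. u + sum (relabel p x) S"
    have "restrict ?g (points S) \<in> ?C"
      using latin_sum_relabel[OF assms(1) p(1)] p(2) bd(1) by (auto simp: completions_def)
    moreover have "klein_affine S (restrict ?g (points S))"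
      using p(1) by (auto simp: klein_affine_def)
    ultimately show False using False by blast
  qed
  from ex_inj_on_two[OF this] obtain e where e: "inj_on e ?C" "e ` ?C \<subseteq> {0, K1}" by blast
  then have "good_index S ?C e" using False by (simp add: good_index_def)
  then show ?thesis by (intro exI[of _ e])
qed

text \<open>The choice depends on \<open>f\<close> only through its set of completions, hence
  through its boundary values. Functions agreeing on the boundary share one indexing, which is what
  makes codes decodable.\<close>

definition completion_index ::
  "'i set \<Rightarrow> (('i \<Rightarrow> klein) \<Rightarrow> klein) \<Rightarrow> (('i \<Rightarrow> klein) \<Rightarrow> klein) \<Rightarrow> klein" where
  "completion_index S f = (SOME e. good_index S (completions S f) e)"

lemma good_completion_index:
  assumes "finite S" "\<not> card S < 2"
  shows "good_index S (completions S f) (completion_index S f)"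
  unfolding completion_index_def using ex_good_index[of S f] assms by (metis not_less someI_ex)

lemma completion_index_cong:
  "completions S f = completions S g \<Longrightarrow> completion_index S f = completion_index S g"
  by (simp add: completion_index_def)

text \<open>Faces of dimension below two get the default 0, since the values on \<open>axes\<close>
  are recorded separately.\<close>

definition completion_code :: "(('i \<Rightarrow> klein) \<Rightarrow> klein) \<Rightarrow> 'i set \<Rightarrow> klein" where
  "completion_code f S = (if card S < 2 then 0
     else completion_index S f (restrict f (points S)))"

lemma completion_code_affine:
  assumes "finite S" "latin S f" "klein_affine S f"
  shows "completion_code f S = 0"
proof (cases "card S < 2")
  case False
  have "good_index S (completions S f) (completion_index S f)"
    by (rule good_completion_index[OF assms(1) False])
  moreover have "klein_affine S (restrict f (points S))"
    using klein_affine_cong[of S "restrict f (points S)" f] assms(3) by simp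
  ultimately show ?thesis using restrict_in_completions[OF assms(2)] False
    by (auto simp: good_index_def completion_code_def)
qed (simp add: completion_code_def)

text \<open>A nonzero index at \<open>T\<close> means that \<open>f\<close> is not affine there.
  Points of \<open>T\<close> are boundary points of \<open>S\<close>, so no completion on
  \<open>S\<close> is affine, and \<open>good_index\<close> then leaves two indices.\<close>

lemma completion_code_in_codes:
  assumes "finite K" "latin K f"
  shows "restrict (completion_code f) (Pow K) \<in> codes (Pow K)"
proof -
  have "completion_code f S \<in> {0, K1}"
    if S: "S \<subseteq> K" and T: "T \<subset> S" and nz: "completion_code f T \<noteq> 0" for S T
  proof (cases "card S < 2")
    case False
    have fin: "finite S" "finite T" using S T assms(1) finite_subset[of S K] finite_subset[of T S] by auto
    have lat: "latin S f" "latin T f" using latin_mono[OF assms(2)] S T by auto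
    have nT: "\<not> klein_affine T f" using completion_code_affine[OF fin(2) lat(2)] nz by blast
    have "\<not> klein_affine S g" if "g \<in> completions S f" for g
    proof
      assume "klein_affine S g"
      then have "klein_affine T g" using T fin(1) by (metis klein_affine_mono psubset_imp_subset)
      moreover have "g x = f x" if "x \<in> points T" for x
      proof -
        have "x \<in> boundary S" using that T unfolding boundary_def points_def by blast
        with \<open>g \<in> completions S f\<close> boundary_subset show ?thesis by (fastforce simp: completions_def)
      qed
      ultimately show False using nT klein_affine_cong[of T g f] by blast
    qed
    moreover note good_completion_index[OF fin(1) False, of f]
    ultimately show ?thesis using restrict_in_completions[OF lat(1)] False
      by (auto simp: good_index_def completion_code_def)
  qed (simp add: completion_code_def)
  then show ?thesis by (auto simp: codes_def)
qed

definition axes :: "'i set \<Rightarrow> ('i \<Rightarrow> klein) set" where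
  "axes K = (\<lambda>(i, v). (\<lambda>_. 0)(i := v)) ` (K \<times> UNIV)"

lemma finite_axes: "finite K \<Longrightarrow> finite (axes K)"
  by (simp add: axes_def)

lemma card_axes_le: "finite K \<Longrightarrow> card (axes K) \<le> 4 * card K"
  using card_image_le[of "K \<times> (UNIV :: klein set)" "\<lambda>(i, v). (\<lambda>_. 0)(i := v)"]
  by (simp add: axes_def card_cartesian_product card_klein)

lemma points_subset_axes:
  assumes "S \<subseteq> K" "K \<noteq> {}" "card S < 2" "finite K"
  shows "points S \<subseteq> axes K"
proof
  fix x :: "'a \<Rightarrow> klein" assume x: "x \<in> points S"
  have "finite S" using assms finite_subset by auto
  obtain i where i: "i \<in> K" "S \<subseteq> {i}"
  proof (cases "S = {}")
    case True
    then show ?thesis using that assms(2) by blast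
  next
    case False
    then have "card S = 1" using assms(3) \<open>finite S\<close> by (metis One_nat_def card_eq_0_iff less_2_cases)
    then show ?thesis using that assms(1) by (auto simp: card_1_singleton_iff)
  qed
  then have "x = (\<lambda>_. 0)(i := x i)" using x by (fastforce simp: points_def fun_eq_iff)
  then show "x \<in> axes K" using i(1) unfolding axes_def by (intro image_eqI[of _ _ "(i, x i)"]) auto
qed

text \<open>Decoding by induction on the face: agreement on the boundary gives the same completions
  with the same injective index, so equal codes select the same completion.\<close>

lemma latin_eq_of_code_eq:
  assumes "finite K" "K \<noteq> {}" "latin K f" "latin K g"
    and ax: "\<And>x. x \<in> axes K \<Longrightarrow> f x = g x"
    and code: "\<And>S. S \<subseteq> K \<Longrightarrow> completion_code f S = completion_code g S"
    and x: "x \<in> points K"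
  shows "f x = g x"
proof -
  have "\<forall>x\<in>points S. f x = g x" if "S \<subseteq> K" for S
    using finite_subset[OF that assms(1)] that
  proof (induction S rule: finite_psubset_induct)
    case (psubset S)
    show ?case
    proof (cases "card S < 2")
      case True
      then show ?thesis using points_subset_axes[OF psubset.prems assms(2) _ assms(1)] ax by blast
    next
      case False
      have "f x = g x" if "x \<in> boundary S" for x
      proof -
        from that obtain i where i: "i \<in> S" "x i = 0" "x \<in> points S" by (auto simp: boundary_def)
        then have "x \<in> points (S - {i})" by (auto simp: points_def)
        moreover have "S - {i} \<subset> S" using i by auto
        ultimately show ?thesis using psubset.IH[of "S - {i}"] psubset.prems by auto
      qed
      then have C: "completions S f = completions S g" by (rule completions_cong)
      have lat: "latin S f" "latin S g" using latin_mono[OF _ psubset.prems] assms(3,4) by auto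
      have "inj_on (completion_index S f) (completions S f)"
        using good_completion_index[OF psubset.hyps(1) False, of f] by (simp add: good_index_def)
      moreover have "completion_index S f (restrict f (points S)) =
        completion_index S f (restrict g (points S))"
        using code[OF psubset.prems] False completion_index_cong[OF C] by (simp add: completion_code_def)
      ultimately have "restrict f (points S) = restrict g (points S)"
        using restrict_in_completions[OF lat(1)] restrict_in_completions[OF lat(2)] C by (metis inj_onD)
      then show ?thesis by (simp add: restrict_points_eq_iff)
    qed
  qed
  then show ?thesis using x by blast
qed

lemma finite_points:
  assumes "finite S" shows "finite (points S)"
proof -
  have "inj_on (\<lambda>x. restrict x S) (points S)"
  proof (rule inj_onI)
    fix x y :: "'a \<Rightarrow> klein"
    assume *: "x \<in> points S" "y \<in> points S" "restrict x S = restrict y S"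
    show "x = y"
    proof
      fix i show "x i = y i"
      proof (cases "i \<in> S")
        case True
        then show ?thesis using *(3) by (metis restrict_apply')
      next
        case False
        then show ?thesis using *(1,2) by (simp add: points_def)
      qed
    qed
  qed
  moreover have "(\<lambda>x. restrict x S) ` points S \<subseteq> S \<rightarrow>\<^sub>E UNIV" by auto
  moreover have "finite (S \<rightarrow>\<^sub>E (UNIV :: klein set))" using assms by (simp add: finite_PiE)
  ultimately show ?thesis by (rule inj_on_finite)
qed

theorem card_latin_le:
  assumes "finite K" "K \<noteq> {}"
  shows "card {f \<in> points K \<rightarrow>\<^sub>E UNIV. latin K f} \<le>
    4 ^ (4 * card K) * (2 ^ 2 ^ card K * 3 ^ chain_count (card K) 1)"
proof -
  let ?Q = "{f \<in> points K \<rightarrow>\<^sub>E UNIV. latin K f}"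
  let ?h = "\<lambda>f. (restrict f (axes K), restrict (completion_code f) (Pow K))"
  have "inj_on ?h ?Q"
  proof (rule inj_onI)
    fix f g assume fg: "f \<in> ?Q" "g \<in> ?Q" and eq: "?h f = ?h g"
    have eqs: "restrict f (axes K) = restrict g (axes K)"
      "restrict (completion_code f) (Pow K) = restrict (completion_code g) (Pow K)"
      using eq by blast+
    have ax: "f x = g x" if "x \<in> axes K" for x using fun_cong[OF eqs(1), of x] that by simp
    have code: "completion_code f S = completion_code g S" if "S \<subseteq> K" for S
      using fun_cong[OF eqs(2), of S] that by simp
    have "f x = g x" if "x \<in> points K" for x
      by (rule latin_eq_of_code_eq[OF assms _ _ ax code that]) (use fg in auto)
    moreover have "f \<in> extensional (points K)" "g \<in> extensional (points K)" using fg by (auto simp: PiE_def)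
    ultimately show "f = g" by (intro extensionalityI)
  qed
  moreover have "?h ` ?Q \<subseteq> (axes K \<rightarrow>\<^sub>E UNIV) \<times> codes (Pow K)"
    using completion_code_in_codes[OF assms(1)] by (intro image_subsetI SigmaI) auto
  moreover have "finite ((axes K \<rightarrow>\<^sub>E (UNIV :: klein set)) \<times> codes (Pow K))"
    using assms by (intro finite_cartesian_product finite_PiE finite_axes finite_codes) auto
  ultimately have "card ?Q \<le> card ((axes K \<rightarrow>\<^sub>E (UNIV :: klein set)) \<times> codes (Pow K))"
    by (rule card_inj_on_le)
  also have "\<dots> = 4 ^ card (axes K) * card (codes (Pow K))"
    using assms by (simp add: card_cartesian_product card_PiE finite_axes card_klein)
  also have "\<dots> \<le> 4 ^ (4 * card K) * (2 ^ 2 ^ card K * 3 ^ chain_count (card K) 1)"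
    using card_axes_le[OF assms(1)] card_codes_Pow[OF assms(1)] by (intro mult_mono power_increasing) auto
  finally show ?thesis .
qed

section \<open>Independent sets of the Shrikhande graph\<close>

text \<open>Here the symbols stand for residues modulo 4 and \<open>cyc\<close> adds 1 to them; this
  is not an addition of the Klein four-group.\<close>

fun cyc :: "klein \<Rightarrow> klein" where
  "cyc K0 = K1" | "cyc K1 = K2" | "cyc K2 = K3" | "cyc K3 = K0"

definition sh_next :: "klein \<times> klein \<Rightarrow> klein \<times> klein \<Rightarrow> bool" where
  "sh_next u v \<longleftrightarrow> v = (cyc (fst u), snd u) \<or> v = (fst u, cyc (snd u)) \<or> v = (cyc (fst u), cyc (snd u))"

definition sh_adj :: "klein \<times> klein \<Rightarrow> klein \<times> klein \<Rightarrow> bool" where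
  "sh_adj u v \<longleftrightarrow> sh_next u v \<or> sh_next v u"

definition rook_adj :: "klein \<times> klein \<Rightarrow> klein \<times> klein \<Rightarrow> bool" where
  "rook_adj u v \<longleftrightarrow> u \<noteq> v \<and> (fst u = fst v \<or> snd u = snd v)"

definition adj_free :: "('a \<Rightarrow> 'a \<Rightarrow> bool) \<Rightarrow> 'a set \<Rightarrow> bool" where
  "adj_free E F \<longleftrightarrow> (\<forall>u\<in>F. \<forall>v\<in>F. \<not> E u v)"

text \<open>Only independent lists are ever extended, which keeps the enumeration small enough to
  evaluate.\<close>

fun independent_lists :: "(klein \<times> klein) list \<Rightarrow> (klein \<times> klein) list list" where
  "independent_lists [] = [[]]"
| "independent_lists (v # vs) = (let L = independent_lists vs in
     L @ map ((#) v) (filter (list_all (\<lambda>y. \<not> sh_adj v y)) L))"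

lemma independent_lists_distinct:
  "distinct vs \<Longrightarrow> ys \<in> set (independent_lists vs) \<Longrightarrow> distinct ys \<and> set ys \<subseteq> set vs"
proof (induction vs arbitrary: ys)
  case (Cons v vs)
  then consider "ys \<in> set (independent_lists vs)"
    | zs where "ys = v # zs" "zs \<in> set (independent_lists vs)"
    by (auto simp: Let_def)
  then show ?case
  proof cases
    case 1
    then show ?thesis using Cons.IH[of ys] Cons.prems(1) by auto
  next
    case 2
    then show ?thesis using Cons.IH[of zs] Cons.prems(1) by auto
  qed
qed simp

lemma independent_lists_complete:
  assumes "F \<subseteq> set vs" "adj_free sh_adj F"
  shows "\<exists>ys\<in>set (independent_lists vs). set ys = F"
  using assms
proof (induction vs arbitrary: F)
  case (Cons v vs)
  have "F - {v} \<subseteq> set vs" "adj_free sh_adj (F - {v})" using Cons.prems by (auto simp: adj_free_def)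
  then obtain ys where ys: "ys \<in> set (independent_lists vs)" "set ys = F - {v}" using Cons.IH by blast
  show ?case
  proof (cases "v \<in> F")
    case True
    then have "list_all (\<lambda>y. \<not> sh_adj v y) ys"
      using ys(2) Cons.prems(2) by (auto simp: list_all_iff adj_free_def)
    then have "v # ys \<in> set (independent_lists (v # vs))" using ys(1) by (simp add: Let_def)
    moreover have "set (v # ys) = F" using ys(2) True by auto
    ultimately show ?thesis by blast
  next
    case False
    then show ?thesis using ys by (auto simp: Let_def)
  qed
qed simp

definition sh_points :: "(klein \<times> klein) list" where
  "sh_points = [(K0, K0), (K0, K1), (K0, K2), (K0, K3), (K1, K0), (K1, K1), (K1, K2), (K1, K3), (K2, K0), (K2, K1), (K2, K2), (K2, K3), (K3, K0), (K3, K1), (K3, K2), (K3, K3)]"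

text \<open>The sixteen independent sets of size four of the Shrikhande graph, each paired with the graph of
  a permutation that is not a 3-cycle.\<close>

definition sh_table :: "((klein \<times> klein) list \<times> (klein \<times> klein) list) list" where
  "sh_table = [
  ([(K0, K0), (K0, K2), (K2, K0), (K2, K2)],
   [(K0, K0), (K1, K1), (K2, K2), (K3, K3)]),
  ([(K0, K0), (K0, K2), (K2, K1), (K2, K3)],
   [(K0, K0), (K1, K1), (K2, K3), (K3, K2)]),
  ([(K0, K0), (K1, K2), (K2, K0), (K3, K2)],
   [(K0, K0), (K1, K3), (K2, K2), (K3, K1)]),
  ([(K0, K0), (K1, K3), (K2, K2), (K3, K1)],
   [(K0, K0), (K1, K2), (K2, K1), (K3, K3)]),
  ([(K0, K1), (K0, K3), (K2, K0), (K2, K2)],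
   [(K0, K1), (K1, K0), (K2, K2), (K3, K3)]),
  ([(K0, K1), (K0, K3), (K2, K1), (K2, K3)],
   [(K0, K1), (K1, K0), (K2, K3), (K3, K2)]),
  ([(K0, K1), (K1, K0), (K2, K3), (K3, K2)],
   [(K0, K1), (K1, K3), (K2, K0), (K3, K2)]),
  ([(K0, K1), (K1, K3), (K2, K1), (K3, K3)],
   [(K0, K1), (K1, K2), (K2, K3), (K3, K0)]),
  ([(K0, K2), (K1, K0), (K2, K2), (K3, K0)],
   [(K0, K2), (K1, K1), (K2, K0), (K3, K3)]),
  ([(K0, K2), (K1, K1), (K2, K0), (K3, K3)],
   [(K0, K3), (K1, K1), (K2, K2), (K3, K0)]),
  ([(K0, K3), (K1, K1), (K2, K3), (K3, K1)],
   [(K0, K3), (K1, K0), (K2, K1), (K3, K2)]),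
  ([(K0, K3), (K1, K2), (K2, K1), (K3, K0)],
   [(K0, K2), (K1, K0), (K2, K3), (K3, K1)]),
  ([(K1, K0), (K1, K2), (K3, K0), (K3, K2)],
   [(K0, K2), (K1, K3), (K2, K0), (K3, K1)]),
  ([(K1, K0), (K1, K2), (K3, K1), (K3, K3)],
   [(K0, K2), (K1, K3), (K2, K1), (K3, K0)]),
  ([(K1, K1), (K1, K3), (K3, K0), (K3, K2)],
   [(K0, K3), (K1, K2), (K2, K0), (K3, K1)]),
  ([(K1, K1), (K1, K3), (K3, K1), (K3, K3)],
   [(K0, K3), (K1, K2), (K2, K1), (K3, K0)])]"

lemma sh_table_complete:
  "list_all (\<lambda>ys. length ys \<le> 4 \<and> (length ys = 4 \<longrightarrow> ys \<in> fst ` set sh_table)) (independent_lists sh_points)"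
  by code_simp

lemma sh_table_perms:
  "list_all (\<lambda>p. length (snd p) = 4 \<and> distinct (snd p) \<and>
     list_all (\<lambda>u. list_all (\<lambda>v. \<not> rook_adj u v) (snd p)) (snd p)) sh_table"
  by code_simp

lemma sh_table_pairs:
  "list_all (\<lambda>p. list_all (\<lambda>q. (fst p \<noteq> fst q \<longrightarrow> \<not> list_all (\<lambda>v. v \<in> set (snd q)) (snd p)) \<and>
     (list_all (\<lambda>v. v \<notin> set (fst q)) (fst p) \<longrightarrow> list_all (\<lambda>v. v \<notin> set (snd q)) (snd p))) sh_table) sh_table"
  by code_simp

lemma set_sh_points: "set sh_points = UNIV"
proof -
  have "x \<in> set sh_points" for x by (cases x; cases "fst x"; cases "snd x") (auto simp: sh_points_def)
  then show ?thesis by auto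
qed

lemma distinct_sh_points: "distinct sh_points"
  by (simp add: sh_points_def)

lemma sh_independent_obtain:
  assumes "adj_free sh_adj F"
  obtains ys where "ys \<in> set (independent_lists sh_points)" "set ys = F" "length ys = card F"
proof -
  obtain ys where ys: "ys \<in> set (independent_lists sh_points)" "set ys = F"
    using independent_lists_complete[of F sh_points] assms set_sh_points by auto
  moreover have "distinct ys" using independent_lists_distinct[OF distinct_sh_points ys(1)] by simp
  then have "length ys = card F" using ys(2) distinct_card[of ys] by simp
  ultimately show ?thesis by (rule that)
qed

lemma sh_independent_card: "adj_free sh_adj F \<Longrightarrow> card F \<le> 4"
  using sh_independent_obtain[of F] bspec[OF sh_table_complete[unfolded list_all_iff]] by metis

text \<open>Injectivity makes a code recoverable from its image; disjointness keeps the images of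
  adjacent fibres apart, which preserves independence in the other directions.\<close>

lemma ex_sh_embedding:
  "\<exists>h. \<forall>F. adj_free sh_adj F \<and> card F = 4 \<longrightarrow> card (h F) = 4 \<and> adj_free rook_adj (h F) \<and>
     (\<forall>F'. adj_free sh_adj F' \<and> card F' = 4 \<longrightarrow>
        (h F = h F' \<longrightarrow> F = F') \<and> (F \<inter> F' = {} \<longrightarrow> h F \<inter> h F' = {}))"
proof -
  define t where "t F = (SOME t. t \<in> set sh_table \<and> set (fst t) = F)" for F
  have t: "t F \<in> set sh_table \<and> set (fst (t F)) = F" if F: "adj_free sh_adj F" "card F = 4" for F
  proof -
    obtain ys where "ys \<in> set (independent_lists sh_points)" "set ys = F" "length ys = card F"
      using sh_independent_obtain[OF F(1)] .
    then have "ys \<in> fst ` set sh_table" "set ys = F" using sh_table_complete F(2) by (auto simp: list_all_iff)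
    then have "\<exists>t. t \<in> set sh_table \<and> set (fst t) = F" by force
    then show ?thesis unfolding t_def by (rule someI_ex)
  qed
  define h where "h F = set (snd (t F))" for F
  have 1: "card (h F) = 4 \<and> adj_free rook_adj (h F)" if F: "adj_free sh_adj F" "card F = 4" for F
  proof -
    have "length (snd (t F)) = 4 \<and> distinct (snd (t F)) \<and>
      (\<forall>u\<in>set (snd (t F)). \<forall>v\<in>set (snd (t F)). \<not> rook_adj u v)"
      using bspec[OF sh_table_perms[unfolded list_all_iff]] t[OF F] by blast
    then show ?thesis using distinct_card[of "snd (t F)"] by (simp add: h_def adj_free_def)
  qed
  have 2: "(h F = h F' \<longrightarrow> F = F') \<and> (F \<inter> F' = {} \<longrightarrow> h F \<inter> h F' = {})"
    if F: "adj_free sh_adj F" "card F = 4" and F': "adj_free sh_adj F'" "card F' = 4" for F F'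
  proof -
    have "(fst (t F) \<noteq> fst (t F') \<longrightarrow> \<not> (\<forall>v\<in>set (snd (t F)). v \<in> set (snd (t F')))) \<and>
      ((\<forall>v\<in>set (fst (t F)). v \<notin> set (fst (t F'))) \<longrightarrow> (\<forall>v\<in>set (snd (t F)). v \<notin> set (snd (t F'))))"
      using bspec[OF bspec[OF sh_table_pairs[unfolded list_all_iff]]] t[OF F] t[OF F'] by blast
    moreover have "set (fst (t F)) = F" "set (fst (t F')) = F'" using t[OF F] t[OF F'] by auto
    ultimately show ?thesis unfolding h_def by (metis disjoint_iff)
  qed
  from 1 2 show ?thesis by (intro exI[of _ h]) blast
qed

section \<open>Codes in product graphs\<close>

lemma card_fibres:
  fixes C :: "('i \<Rightarrow> 'v :: finite) set"
  assumes "finite B" "\<And>z. z \<in> C \<Longrightarrow> z(r := c) \<in> B" "\<And>z. z \<in> B \<Longrightarrow> z r = c"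
  shows "card C = (\<Sum>z\<in>B. card {a. z(r := a) \<in> C})"
proof -
  have "bij_betw (\<lambda>(z, a). z(r := a)) (SIGMA z:B. {a. z(r := a) \<in> C}) C"
  proof (rule bij_betw_byWitness[where f' = "\<lambda>z. (z(r := c), z r)"])
    show "\<forall>p\<in>SIGMA z:B. {a. z(r := a) \<in> C}. (\<lambda>z. (z(r := c), z r)) ((\<lambda>(z, a). z(r := a)) p) = p"
      using assms(3) by (auto simp: fun_eq_iff)
  qed (use assms(2) in auto)
  then have "card C = card (SIGMA z:B. {a. z(r := a) \<in> C})" by (simp add: bij_betw_same_card)
  also have "\<dots> = (\<Sum>z\<in>B. card {a. z(r := a) \<in> C})" using assms(1) by (simp add: card_SigmaI)
  finally show ?thesis .
qed

lemma sum_eq_bound: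
  fixes g :: "'a \<Rightarrow> nat"
  assumes "finite B" "\<And>b. b \<in> B \<Longrightarrow> g b \<le> k" "k * card B \<le> sum g B" "b \<in> B"
  shows "g b = k"
proof (rule ccontr)
  assume "g b \<noteq> k"
  then have "g b < k" using assms(2)[OF assms(4)] by simp
  then have "sum g B < sum (\<lambda>_. k) B" using assms(1,2,4) by (intro sum_strict_mono_ex1) auto
  with assms(3) show False by (simp add: mult.commute)
qed

text \<open>Alphabet and adjacency vary with the coordinate, so products mixing Shrikhande, rook and
  complete factors form one family in which factors can be exchanged singly.\<close>

definition product_independent ::
  "'i set \<Rightarrow> ('i \<Rightarrow> 'v set) \<Rightarrow> ('i \<Rightarrow> 'v \<Rightarrow> 'v \<Rightarrow> bool) \<Rightarrow> ('i \<Rightarrow> 'v) set \<Rightarrow> bool" where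
  "product_independent I A E C \<longleftrightarrow> C \<subseteq> Pi\<^sub>E I A \<and> (\<forall>z\<in>C. \<forall>i\<in>I. \<forall>a. z(i := a) \<in> C \<longrightarrow> \<not> E i (z i) a)"

definition product_codes ::
  "'i set \<Rightarrow> ('i \<Rightarrow> 'v set) \<Rightarrow> ('i \<Rightarrow> 'v \<Rightarrow> 'v \<Rightarrow> bool) \<Rightarrow> ('i \<Rightarrow> 'v) set set" where
  "product_codes I A E = {C. product_independent I A E C \<and> 4 * card C = card (Pi\<^sub>E I A)}"

lemma finite_product_codes:
  fixes A :: "'i \<Rightarrow> 'v :: finite set"
  assumes "finite I" shows "finite (product_codes I A E)"
proof (rule finite_subset)
  show "product_codes I A E \<subseteq> Pow (Pi\<^sub>E I A)" by (auto simp: product_codes_def product_independent_def)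
  show "finite (Pow (Pi\<^sub>E I A))" using assms by (simp add: finite_PiE)
qed

lemma PiE_upd: "z \<in> Pi\<^sub>E I A \<Longrightarrow> i \<in> I \<Longrightarrow> a \<in> A i \<Longrightarrow> z(i := a) \<in> Pi\<^sub>E I A"
  by (auto simp: PiE_def extensional_def)

lemma card_PiE_fibres:
  fixes A :: "'i \<Rightarrow> 'v :: finite set"
  assumes "finite I" "r \<in> I" "c \<in> A r"
  shows "card (Pi\<^sub>E I A) = card (A r) * card {z \<in> Pi\<^sub>E I A. z r = c}"
proof -
  let ?B = "{z \<in> Pi\<^sub>E I A. z r = c}"
  have fin: "finite ?B" using finite_PiE[OF assms(1), of A] by simp
  have "card (Pi\<^sub>E I A) = (\<Sum>z\<in>?B. card {a. z(r := a) \<in> Pi\<^sub>E I A})"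
  proof (rule card_fibres[OF fin])
    show "z(r := c) \<in> ?B" if "z \<in> Pi\<^sub>E I A" for z
      using PiE_upd[of z I A r c] that assms(2,3) by auto
  qed simp
  also have "\<dots> = (\<Sum>z\<in>?B. card (A r))"
  proof (rule sum.cong)
    fix z assume "z \<in> ?B"
    then have "{a. z(r := a) \<in> Pi\<^sub>E I A} = A r"
      using assms(2) PiE_upd[of z I A r] PiE_mem[of "z(r := _)" I A r] by fastforce
    then show "card {a. z(r := a) \<in> Pi\<^sub>E I A} = card (A r)" by simp
  qed simp
  finally show ?thesis by (simp add: mult.commute)
qed

text \<open>Averaging over the lines in direction \<open>r\<close>: no fibre exceeds a quarter of
  the alphabet, so equality of the total forces equality in every fibre.\<close>

lemma product_independent_card_le:
  fixes A :: "'i \<Rightarrow> 'v :: finite set"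
  assumes "finite I" "r \<in> I" "c \<in> A r" and C: "product_independent I A E C"
    and bound: "\<And>F. F \<subseteq> A r \<Longrightarrow> adj_free (E r) F \<Longrightarrow> 4 * card F \<le> card (A r)"
  shows "4 * card C \<le> card (Pi\<^sub>E I A)"
    and "4 * card C = card (Pi\<^sub>E I A) \<Longrightarrow> z \<in> Pi\<^sub>E I A \<Longrightarrow>
      adj_free (E r) {a. z(r := a) \<in> C} \<and> 4 * card {a. z(r := a) \<in> C} = card (A r)"
proof -
  let ?B = "{z \<in> Pi\<^sub>E I A. z r = c}"
  have fin: "finite ?B" using finite_PiE[OF assms(1), of A] by simp
  have CX: "C \<subseteq> Pi\<^sub>E I A" using C by (simp add: product_independent_def)
  have sub: "{a. z(r := a) \<in> C} \<subseteq> A r" for z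
    using CX assms(2) PiE_mem[of "z(r := _)" I A r] by fastforce
  have ind: "adj_free (E r) {a. z(r := a) \<in> C}" for z
    unfolding adj_free_def
  proof (intro ballI)
    fix a b assume "a \<in> {a. z(r := a) \<in> C}" "b \<in> {a. z(r := a) \<in> C}"
    then have "z(r := a) \<in> C" "(z(r := a))(r := b) \<in> C" by auto
    with C assms(2) show "\<not> E r a b" unfolding product_independent_def by fastforce
  qed
  have card_C: "card C = (\<Sum>z\<in>?B. card {a. z(r := a) \<in> C})"
  proof (rule card_fibres[OF fin])
    show "z(r := c) \<in> ?B" if "z \<in> C" for z
      using PiE_upd[of z I A r c] CX that assms(2,3) by auto
  qed simp
  have "4 * card C = (\<Sum>z\<in>?B. 4 * card {a. z(r := a) \<in> C})" by (simp add: card_C sum_distrib_left)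
  also have "\<dots> \<le> (\<Sum>z\<in>?B. card (A r))" by (intro sum_mono bound sub ind)
  finally show "4 * card C \<le> card (Pi\<^sub>E I A)" using card_PiE_fibres[of I r c A, OF assms(1,2,3)] by (simp add: mult.commute)
  assume eq: "4 * card C = card (Pi\<^sub>E I A)" and z: "z \<in> Pi\<^sub>E I A"
  have zB: "z(r := c) \<in> ?B" using PiE_upd[OF z assms(2,3)] by simp
  have "4 * card {a. (z(r := c))(r := a) \<in> C} = card (A r)"
  proof (rule sum_eq_bound[OF fin _ _ zB])
    show "4 * card {a. z(r := a) \<in> C} \<le> card (A r)" for z by (rule bound[OF sub ind])
    show "card (A r) * card ?B \<le> (\<Sum>z\<in>?B. 4 * card {a. z(r := a) \<in> C})"
      using eq card_PiE_fibres[of I r c A, OF assms(1,2,3)] by (simp add: card_C sum_distrib_left)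
  qed
  with ind show "adj_free (E r) {a. z(r := a) \<in> C} \<and> 4 * card {a. z(r := a) \<in> C} = card (A r)" by simp
qed

lemma card_product_codes_rook:
  fixes A :: "'i \<Rightarrow> (klein \<times> klein) set"
  assumes "finite I" "r \<in> I" "A r = UNIV" "E r = sh_adj"
  shows "card (product_codes I A E) \<le> card (product_codes I A (E(r := rook_adj)))"
proof -
  obtain h where h: "\<forall>F. adj_free sh_adj F \<and> card F = 4 \<longrightarrow> card (h F) = 4 \<and> adj_free rook_adj (h F) \<and>
     (\<forall>F'. adj_free sh_adj F' \<and> card F' = 4 \<longrightarrow>
        (h F = h F' \<longrightarrow> F = F') \<and> (F \<inter> F' = {} \<longrightarrow> h F \<inter> h F' = {}))"
    using ex_sh_embedding by (rule exE)
  have h4: "card (h F) = 4" and hr: "adj_free rook_adj (h F)" if "adj_free sh_adj F" "card F = 4" for F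
    using h that by blast+
  have h_inj: "h F = h F' \<Longrightarrow> F = F'" and h_disj: "F \<inter> F' = {} \<Longrightarrow> h F \<inter> h F' = {}"
    if "adj_free sh_adj F" "card F = 4" "adj_free sh_adj F'" "card F' = 4" for F F'
    using h that by blast+
  let ?X = "Pi\<^sub>E I A"
  let ?B = "{z \<in> ?X. z r = (0, 0)}"
  have finX: "finite ?X" using assms(1) by (simp add: finite_PiE)
  then have finB: "finite ?B" by simp
  have upd: "z(r := a) \<in> ?X" if "z \<in> ?X" for z a using PiE_upd[OF that assms(2)] assms(3) by simp
  define fib where "fib C z = {a. z(r := a) \<in> C}" for C and z :: "'i \<Rightarrow> klein \<times> klein"
  have fib_upd: "fib C (z(r := a)) = fib C z" for C z a by (simp add: fib_def)
  have fib: "adj_free sh_adj (fib C z) \<and> card (fib C z) = 4"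
    if "C \<in> product_codes I A E" "z \<in> ?X" for C z
  proof -
    have "adj_free (E r) {a. z(r := a) \<in> C} \<and> 4 * card {a. z(r := a) \<in> C} = card (A r)"
    proof (rule product_independent_card_le(2)[OF assms(1,2)])
      show "(0, 0) \<in> A r" by (simp add: assms(3))
      show "4 * card F \<le> card (A r)" if "adj_free (E r) F" for F
        using sh_independent_card[of F] that by (simp add: assms(3,4))
    qed (use that in \<open>auto simp: product_codes_def\<close>)
    then show ?thesis by (simp add: assms(3,4) fib_def)
  qed
  define \<Phi> where "\<Phi> C = {z \<in> ?X. z r \<in> h (fib C z)}" for C
  have fib_\<Phi>: "{a. z(r := a) \<in> \<Phi> C} = h (fib C z)" if "z \<in> ?X" for C z
    using upd[OF that] by (auto simp: \<Phi>_def fib_upd)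
  have "inj_on \<Phi> (product_codes I A E)"
  proof (rule inj_onI)
    fix C D assume C: "C \<in> product_codes I A E" and D: "D \<in> product_codes I A E" and eq: "\<Phi> C = \<Phi> D"
    have "fib C z = fib D z" if z: "z \<in> ?X" for z
    proof (rule h_inj)
      show "h (fib C z) = h (fib D z)" using fib_\<Phi>[OF z] eq by metis
    qed (use fib C D z in auto)
    moreover have "z \<in> C \<longleftrightarrow> z r \<in> fib C z" for z C by (simp add: fib_def)
    moreover have "C \<subseteq> ?X" "D \<subseteq> ?X" using C D by (auto simp: product_codes_def product_independent_def)
    ultimately show "C = D" by blast
  qed
  moreover have "\<Phi> C \<in> product_codes I A (E(r := rook_adj))" if C: "C \<in> product_codes I A E" for C
  proof -
    have ind: "product_independent I A E C" and cardC: "4 * card C = card ?X"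
      using C by (auto simp: product_codes_def)
    have "\<not> (E(r := rook_adj)) i (z i) a" if z: "z \<in> \<Phi> C" and i: "i \<in> I" and za: "z(i := a) \<in> \<Phi> C" for z i a
    proof (cases "i = r")
      case True
      have zX: "z \<in> ?X" using z by (simp add: \<Phi>_def)
      have "z r \<in> h (fib C z)" "a \<in> h (fib C z)" using z za True by (auto simp: \<Phi>_def fib_upd)
      then show ?thesis using True hr[of "fib C z"] fib[OF C zX] by (auto simp: adj_free_def)
    next
      case False
      have zX: "z \<in> ?X" "z(i := a) \<in> ?X" using z za by (auto simp: \<Phi>_def)
      have "z r \<in> h (fib C z) \<inter> h (fib C (z(i := a)))" using z za False by (auto simp: \<Phi>_def)
      \<comment> \<open>A common element of the two fibres gives two points of \<open>C\<close> that
        differ at most in coordinate \<open>i\<close>.\<close>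
      then have "fib C z \<inter> fib C (z(i := a)) \<noteq> {}" using h_disj fib[OF C zX(1)] fib[OF C zX(2)] by blast
      then obtain b where "z(r := b) \<in> C" "(z(i := a))(r := b) \<in> C" by (auto simp: fib_def)
      then have "z(r := b) \<in> C" "(z(r := b))(i := a) \<in> C" using False by (auto simp: fun_upd_twist)
      then have "\<not> E i ((z(r := b)) i) a" using ind i unfolding product_independent_def by blast
      then show ?thesis using False by simp
    qed
    then have "product_independent I A (E(r := rook_adj)) (\<Phi> C)"
      unfolding product_independent_def by (auto simp: \<Phi>_def)
    moreover have "card (\<Phi> C) = (\<Sum>z\<in>?B. card {a. z(r := a) \<in> \<Phi> C})"
      by (rule card_fibres[OF finB]) (auto simp: \<Phi>_def upd)
    moreover have "\<dots> = (\<Sum>z\<in>?B. 4)"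
      using fib_\<Phi> h4 fib[OF C] by (intro sum.cong) auto
    moreover have "card ?X = 16 * card ?B"
      using card_PiE_fibres[OF assms(1,2), of "(0, 0)" A] assms(3) by simp
    ultimately show ?thesis by (simp add: product_codes_def)
  qed
  then have "\<Phi> ` product_codes I A E \<subseteq> product_codes I A (E(r := rook_adj))" by blast
  ultimately show ?thesis using finite_product_codes[OF assms(1)] by (rule card_inj_on_le)
qed

text \<open>Coordinates below \<open>m\<close> are Shrikhande factors, the first \<open>k\<close> of which have been replaced by the rook
  graph \<open>K\<^sub>4 \<times> K\<^sub>4\<close>; the others are copies of \<open>K\<^sub>4\<close>, embedded as a line of the rook graph.\<close>

definition coord_set :: "nat \<Rightarrow> nat \<Rightarrow> (klein \<times> klein) set" where
  "coord_set m i = (if i < m then UNIV else UNIV \<times> {0})"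

definition coord_adj :: "nat \<Rightarrow> nat \<Rightarrow> nat \<Rightarrow> klein \<times> klein \<Rightarrow> klein \<times> klein \<Rightarrow> bool" where
  "coord_adj k m i = (if k \<le> i \<and> i < m then sh_adj else rook_adj)"

lemma card_product_codes_all_rook:
  assumes "k \<le> m"
  shows "card (product_codes {..<m + n} (coord_set m) (coord_adj 0 m)) \<le>
    card (product_codes {..<m + n} (coord_set m) (coord_adj k m))"
  using assms
proof (induction k)
  case (Suc k)
  have "card (product_codes {..<m + n} (coord_set m) (coord_adj k m)) \<le>
    card (product_codes {..<m + n} (coord_set m) ((coord_adj k m)(k := rook_adj)))"
    using Suc.prems by (intro card_product_codes_rook) (auto simp: coord_set_def coord_adj_def)
  moreover have "(coord_adj k m)(k := rook_adj) = coord_adj (Suc k) m"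
    by (auto simp: coord_adj_def fun_eq_iff)
  ultimately show ?case using Suc by simp
qed simp

section \<open>Upper and lower bounds for product codes\<close>

definition hamming_index :: "nat \<Rightarrow> nat \<Rightarrow> (nat \<times> bool) set" where
  "hamming_index m n = {..<m + n} \<times> {False} \<union> {..<m} \<times> {True}"

text \<open>A rook factor is folded from two coordinates. For a single \<open>K4\<close> factor the
  index \<open>(i, True)\<close> is absent, and the second entry is 0 because points vanish outside
  \<open>hamming_index\<close>.\<close>

definition fold_coords :: "nat \<Rightarrow> nat \<Rightarrow> (nat \<times> bool \<Rightarrow> klein) \<Rightarrow> nat \<Rightarrow> klein \<times> klein" where
  "fold_coords m n x = restrict (\<lambda>i. (x (i, False), x (i, True))) {..<m + n}"

lemma finite_hamming_index: "finite (hamming_index m n)"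
  by (simp add: hamming_index_def)

lemma card_hamming_index: "card (hamming_index m n) = 2 * m + n"
  unfolding hamming_index_def by (subst card_Un_disjoint) auto

lemma bij_betw_fold_coords:
  "bij_betw (fold_coords m n) (points (hamming_index m n)) (Pi\<^sub>E {..<m + n} (coord_set m))"
proof (rule bij_betw_byWitness[where
      f' = "\<lambda>z (i, b). if i < m + n then if b then snd (z i) else fst (z i) else 0"])
  show "\<forall>x\<in>points (hamming_index m n).
      (\<lambda>(i, b). if i < m + n then if b then snd (fold_coords m n x i) else fst (fold_coords m n x i) else 0) = x"
  proof (intro ballI ext)
    fix x and p :: "nat \<times> bool" assume "x \<in> points (hamming_index m n)"
    then have x: "x p = 0" if "p \<notin> hamming_index m n" for p using that unfolding points_def by blast
    obtain i b where p: "p = (i, b)" by fastforce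
    show "(\<lambda>(i, b). if i < m + n then if b then snd (fold_coords m n x i) else fst (fold_coords m n x i) else 0) p = x p"
      using x[of p] by (cases b) (auto simp: p fold_coords_def hamming_index_def)
  qed
  show "\<forall>z\<in>Pi\<^sub>E {..<m + n} (coord_set m). fold_coords m n
      (\<lambda>(i, b). if i < m + n then if b then snd (z i) else fst (z i) else 0) = z"
  proof (intro ballI ext)
    fix z i assume "z \<in> Pi\<^sub>E {..<m + n} (coord_set m)"
    then have "z i = undefined" if "\<not> i < m + n" using that by (auto simp: PiE_def extensional_def)
    then show "fold_coords m n (\<lambda>(i, b). if i < m + n then if b then snd (z i) else fst (z i) else 0) i = z i"
      by (cases "i < m + n") (auto simp: fold_coords_def)
  qed
  show "fold_coords m n ` points (hamming_index m n) \<subseteq> Pi\<^sub>E {..<m + n} (coord_set m)"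
  proof (intro image_subsetI)
    fix x assume "x \<in> points (hamming_index m n)"
    then have "x (i, True) = 0" if "\<not> i < m" for i
      using that unfolding points_def hamming_index_def by blast
    then show "fold_coords m n x \<in> Pi\<^sub>E {..<m + n} (coord_set m)"
      by (simp add: fold_coords_def coord_set_def restrict_PiE_iff)
  qed
  show "(\<lambda>z (i, b). if i < m + n then if b then snd (z i) else fst (z i) else 0) ` Pi\<^sub>E {..<m + n} (coord_set m)
      \<subseteq> points (hamming_index m n)"
  proof (intro image_subsetI)
    fix z assume z: "z \<in> Pi\<^sub>E {..<m + n} (coord_set m)"
    have "snd (z i) = 0" if "m \<le> i" "i < m + n" for i
      using PiE_mem[OF z, of i] that by (auto simp: coord_set_def)
    then show "(\<lambda>(i, b). if i < m + n then if b then snd (z i) else fst (z i) else 0) \<in> points (hamming_index m n)"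
      by (auto simp: points_def hamming_index_def not_less)
  qed
qed

lemma fold_coords_upd:
  "i < m + n \<Longrightarrow> fold_coords m n (x((i, b) := v)) =
     (fold_coords m n x)(i := if b then (x (i, False), v) else (v, x (i, True)))"
  by (auto simp: fold_coords_def fun_eq_iff)

lemma card_points_fibres:
  assumes "finite J" "j \<in> J"
  shows "card (points J) = 4 * card (points (J - {j}))"
proof -
  have "card (points J) = (\<Sum>x\<in>points (J - {j}). card {v. x(j := v) \<in> points J})"
    using assms by (intro card_fibres[where c = 0] finite_points) (auto simp: points_def)
  also have "\<dots> = (\<Sum>x\<in>points (J - {j}). 4)"
  proof (rule sum.cong)
    fix x :: "'a \<Rightarrow> klein" assume "x \<in> points (J - {j})"
    then have "{v. x(j := v) \<in> points J} = UNIV" using assms(2) by (auto simp: points_def)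
    then show "card {v. x(j := v) \<in> points J} = 4" by simp
  qed simp
  finally show ?thesis by simp
qed

text \<open>A code meets every line at most once and has a quarter of the points, so it meets each
  line in direction \<open>j\<close> exactly once: entry \<open>j\<close> is a function of the
  others. This function is Latin because of the lines in the other directions.\<close>

lemma card_rook_codes_le_latin:
  assumes j: "j \<in> hamming_index m n"
  shows "card (product_codes {..<m + n} (coord_set m) (\<lambda>_. rook_adj)) \<le>
    card {f \<in> points (hamming_index m n - {j}) \<rightarrow>\<^sub>E UNIV. latin (hamming_index m n - {j}) f}"
proof -
  let ?J = "hamming_index m n"
  let ?T = "?J - {j}"
  let ?F = "fold_coords m n"
  let ?P = "product_codes {..<m + n} (coord_set m) (\<lambda>_. rook_adj)"
  let ?Q = "{f \<in> points ?T \<rightarrow>\<^sub>E UNIV. latin ?T f}"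
  have finT: "finite (points ?T)" by (intro finite_points finite_Diff finite_hamming_index)
  note bij = bij_betw_fold_coords[of m n]
  define D where "D C = {x \<in> points ?J. ?F x \<in> C}" for C
  define g where "g C = restrict (\<lambda>x. THE v. x(j := v) \<in> D C) (points ?T)" for C
  have F_D: "?F ` D C = C" if "C \<in> ?P" for C
  proof -
    have "?F ` D C = ?F ` points ?J \<inter> C" by (auto simp: D_def)
    then show ?thesis using that bij_betw_imp_surj_on[OF bij]
      by (auto simp: product_codes_def product_independent_def)
  qed
  have line: "v = w" if C: "C \<in> ?P" and k: "k \<in> ?J" and "x(k := v) \<in> D C" "x(k := w) \<in> D C" for C x k v w
  proof (rule ccontr)
    assume vw: "v \<noteq> w"
    obtain i b where ib: "k = (i, b)" "i < m + n" using k by (auto simp: hamming_index_def)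
    define a where "a u = (if b then (x (i, False), u) else (u, x (i, True)))" for u
    have F: "?F (x(k := u)) = (?F x)(i := a u)" for u using fold_coords_upd[OF ib(2), of x b u] by (simp add: ib a_def)
    have "(?F x)(i := a v) \<in> C" "((?F x)(i := a v))(i := a w) \<in> C"
      using that(3,4) by (auto simp: D_def F)
    then have "\<not> rook_adj (((?F x)(i := a v)) i) (a w)"
      using C ib(2) unfolding product_codes_def product_independent_def by blast
    then show False using vw by (auto simp: rook_adj_def a_def split: if_splits)
  qed
  have ex: "\<exists>v. x(j := v) \<in> D C" if C: "C \<in> ?P" and x: "x \<in> points ?T" for C x
  proof -
    have CX: "C \<subseteq> Pi\<^sub>E {..<m + n} (coord_set m)" and cardC: "4 * card C = card (Pi\<^sub>E {..<m + n} (coord_set m))"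
      using C by (auto simp: product_codes_def product_independent_def)
    have "bij_betw ?F (D C) C"
    proof (rule bij_betw_subset[OF bij])
      show "?F ` D C = C" by (rule F_D[OF C])
    qed (auto simp: D_def)
    then have "card (D C) = card C" by (rule bij_betw_same_card)
    moreover have "card (points ?J) = card (Pi\<^sub>E {..<m + n} (coord_set m))"
      using bij by (rule bij_betw_same_card)
    ultimately have "card (D C) = card (points ?T)"
      using cardC card_points_fibres[OF finite_hamming_index j] by simp
    moreover have "card (D C) = (\<Sum>x\<in>points ?T. card {v. x(j := v) \<in> D C})"
    proof (rule card_fibres[OF finT])
      show "z(j := 0) \<in> points ?T" if "z \<in> D C" for z
        using that unfolding D_def points_def by (auto simp del: split_paired_All)
      show "z j = 0" if "z \<in> points ?T" for z using that unfolding points_def by blast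
    qed
    moreover have le1: "card {v. x(j := v) \<in> D C} \<le> 1" for x
      using line[OF C j] by (auto simp: card_le_Suc0_iff_eq)
    ultimately have "card {v. x(j := v) \<in> D C} = 1"
      using sum_eq_bound[OF finT, of "\<lambda>x. card {v. x(j := v) \<in> D C}" 1 x] x by simp
    then have "{v. x(j := v) \<in> D C} \<noteq> {}" by (metis card.empty zero_neq_one)
    then show ?thesis by blast
  qed
  have g: "x(j := v) \<in> D C \<longleftrightarrow> g C x = v" if C: "C \<in> ?P" and x: "x \<in> points ?T" for C x v
  proof -
    have "\<exists>!v. x(j := v) \<in> D C" using ex[OF that] line[OF C j] by blast
    moreover have "g C x = (THE v. x(j := v) \<in> D C)" using x by (simp add: g_def)
    ultimately show ?thesis using theI'[of "\<lambda>v. x(j := v) \<in> D C"] by metis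
  qed
  have "inj_on g ?P"
  proof (rule inj_onI)
    fix C C' assume C: "C \<in> ?P" and C': "C' \<in> ?P" and eq: "g C = g C'"
    have "x \<in> D C \<longleftrightarrow> x \<in> D C'" if x: "x \<in> points ?J" for x
    proof -
      have "x(j := 0) \<in> points ?T" using x by (auto simp: points_def)
      then have "(x(j := 0))(j := x j) \<in> D C \<longleftrightarrow> (x(j := 0))(j := x j) \<in> D C'"
        using g[OF C] g[OF C'] eq by metis
      then show ?thesis by simp
    qed
    then have "D C = D C'" unfolding D_def by blast
    then show "C = C'" using F_D[OF C] F_D[OF C'] by metis
  qed
  moreover have "g C \<in> ?Q" if C: "C \<in> ?P" for C
  proof -
    have "latin ?T (g C)" unfolding latin_def
    proof (intro ballI injI)
      fix x i v w assume x: "x \<in> points ?T" and i: "i \<in> ?T" and eq: "g C (x(i := v)) = g C (x(i := w))"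
      have "(x(i := u))(j := a) = (x(j := a))(i := u)" for u a
        by (rule fun_upd_twist) (use i in auto)
      moreover have "(x(i := u))(j := g C (x(i := u))) \<in> D C" for u
        using g[OF C points_upd[OF x i]] by blast
      ultimately have mem: "(x(j := g C (x(i := u))))(i := u) \<in> D C" for u by simp
      show "v = w"
      proof (rule line[OF C])
        show "(x(j := g C (x(i := v))))(i := v) \<in> D C" by (rule mem)
        show "(x(j := g C (x(i := v))))(i := w) \<in> D C" unfolding eq by (rule mem)
      qed (use i in simp)
    qed
    moreover have "g C \<in> points ?T \<rightarrow>\<^sub>E UNIV" by (simp add: g_def)
    ultimately show ?thesis by simp
  qed
  then have "g ` ?P \<subseteq> ?Q" by blast
  moreover have "finite ?Q"
    by (rule finite_subset[of _ "points ?T \<rightarrow>\<^sub>E UNIV"]) (auto intro: finite_PiE finT)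
  ultimately show ?thesis by (rule card_inj_on_le)
qed

lemma card_doob_codes_le:
  assumes "2 * m + n \<ge> 2"
  defines "k \<equiv> 2 * m + n - 1"
  shows "card (product_codes {..<m + n} (coord_set m) (coord_adj 0 m)) \<le>
    4 ^ (4 * k) * (2 ^ 2 ^ k * 3 ^ chain_count k 1)"
proof -
  have j: "(0, False) \<in> hamming_index m n" using assms by (auto simp: hamming_index_def)
  have card_T: "card (hamming_index m n - {(0, False)}) = k"
    using j by (simp add: card_hamming_index k_def finite_hamming_index)
  have "hamming_index m n - {(0, False)} \<noteq> {}"
  proof
    assume "hamming_index m n - {(0, False)} = {}"
    then have "k = 0" using card_T by (simp only: card.empty)
    then show False using assms(1) by (simp add: k_def)
  qed
  have "coord_adj m m = (\<lambda>_. rook_adj)" by (auto simp: coord_adj_def fun_eq_iff)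
  then have "card (product_codes {..<m + n} (coord_set m) (coord_adj 0 m)) \<le>
    card (product_codes {..<m + n} (coord_set m) (\<lambda>_. rook_adj))"
    using card_product_codes_all_rook[of m m n] by simp
  also have "\<dots> \<le> card {f \<in> points (hamming_index m n - {(0, False)}) \<rightarrow>\<^sub>E UNIV. latin (hamming_index m n - {(0, False)}) f}"
    by (rule card_rook_codes_le_latin[OF j])
  also have "\<dots> \<le> 4 ^ (4 * k) * (2 ^ 2 ^ k * 3 ^ chain_count k 1)"
    using card_latin_le[of "hamming_index m n - {(0, False)}"] finite_hamming_index
      \<open>hamming_index m n - {(0, False)} \<noteq> {}\<close> card_T by simp
  finally show ?thesis .
qed

section \<open>Lower bound: codes from parity bits\<close>

definition sh_weight :: "klein \<times> klein \<Rightarrow> klein" where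
  "sh_weight a = (if fst a = K1 \<or> fst a = K3 then K1 else 0) + (if snd a = K1 \<or> snd a = K3 then K2 else 0)"

text \<open>A step that changes the first residue by 1 flips its parity and so takes the sum of the
  weights out of {0, \<open>K2\<close>}; every other step keeps the first residue and flips the
  parity of the second.\<close>

lemma sh_adj_weight:
  assumes "sh_adj a b"
  shows "fst a = fst b \<and> sh_weight a \<noteq> sh_weight b \<or> sh_weight a + sh_weight b \<notin> {0, K2}"
proof -
  have "list_all (\<lambda>a. list_all (\<lambda>b. sh_adj a b \<longrightarrow>
      fst a = fst b \<and> sh_weight a \<noteq> sh_weight b \<or> sh_weight a + sh_weight b \<notin> {0, K2}) sh_points) sh_points"
    by code_simp
  then have "\<forall>a\<in>UNIV. \<forall>b\<in>UNIV. sh_adj a b \<longrightarrow>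
      fst a = fst b \<and> sh_weight a \<noteq> sh_weight b \<or> sh_weight a + sh_weight b \<notin> {0, K2}"
    unfolding list_all_iff set_sh_points .
  with assms show ?thesis by blast
qed

definition weight :: "nat \<Rightarrow> nat \<Rightarrow> klein \<times> klein \<Rightarrow> klein" where
  "weight m i a = (if i < m then sh_weight a else fst a)"

text \<open>The representative keeps exactly what the second bit sum may depend on: the first
  residue of a Shrikhande vertex, or the first bit of a \<open>K4\<close> symbol, which is set in
  \<open>K1\<close> and \<open>K3\<close>.\<close>

definition normal :: "nat \<Rightarrow> nat \<Rightarrow> klein \<times> klein \<Rightarrow> klein \<times> klein" where
  "normal m i a = (if i < m then (fst a, 0) else (if fst a \<in> {K1, K3} then K1 else 0, 0))"

definition total_weight :: "nat \<Rightarrow> nat \<Rightarrow> (nat \<Rightarrow> klein \<times> klein) \<Rightarrow> klein" where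
  "total_weight m n z = (\<Sum>i<m + n. weight m i (z i))"

definition normal_point :: "nat \<Rightarrow> nat \<Rightarrow> (nat \<Rightarrow> klein \<times> klein) \<Rightarrow> nat \<Rightarrow> klein \<times> klein" where
  "normal_point m n z = restrict (\<lambda>i. normal m i (z i)) {..<m + n}"

definition normal_points :: "nat \<Rightarrow> nat \<Rightarrow> (nat \<Rightarrow> klein \<times> klein) set" where
  "normal_points m n = Pi\<^sub>E {..<m + n} (\<lambda>i. if i < m then UNIV \<times> {0} else {0, K1} \<times> {0})"

text \<open>\<open>L\<close> is the arbitrary function in the guise of a set. The shift
  \<open>u\<close> gives four parallel sets, from which the size is determined.\<close>

definition semilinear :: "nat \<Rightarrow> nat \<Rightarrow> (nat \<Rightarrow> klein \<times> klein) set \<Rightarrow> klein \<Rightarrow> (nat \<Rightarrow> klein \<times> klein) set" where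
  "semilinear m n L u = {z \<in> Pi\<^sub>E {..<m + n} (coord_set m).
     total_weight m n z = u + (if normal_point m n z \<in> L then K2 else 0)}"

lemma total_weight_upd:
  assumes "i < m + n"
  shows "total_weight m n (z(i := a)) = total_weight m n z + weight m i (z i) + weight m i a"
proof -
  have "total_weight m n (z(i := a)) = sum ((\<lambda>i. weight m i (z i))(i := weight m i a)) {..<m + n}"
    unfolding total_weight_def by (intro sum.cong) auto
  also have "\<dots> = total_weight m n z + weight m i (z i) + weight m i a"
    using assms by (subst sum_upd) (auto simp: total_weight_def)
  finally show ?thesis .
qed

lemma coord_adj_weight:
  assumes "coord_adj 0 m i a b" "a \<in> coord_set m i" "b \<in> coord_set m i"
  shows "normal m i a = normal m i b \<and> weight m i a \<noteq> weight m i b \<or> weight m i a + weight m i b \<notin> {0, K2}"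
proof (cases "i < m")
  case True
  then show ?thesis using sh_adj_weight[of a b] assms(1)
    by (simp add: coord_adj_def normal_def weight_def)
next
  case False
  have "\<forall>a b. a \<noteq> b \<longrightarrow> (if a \<in> {K1, K3} then K1 else 0) = (if b \<in> {K1, K3} then K1 else 0) \<or> a + b \<notin> {0, K2}"
    by (simp add: all_klein zero_klein_def)
  then show ?thesis using assms False
    by (cases a; cases b) (auto simp: coord_adj_def normal_def weight_def rook_adj_def coord_set_def)
qed

text \<open>Along an edge, either the normal point stays and the total weight changes, or the first
  bit of the total weight changes. Membership of both ends tolerates neither.\<close>

lemma semilinear_independent:
  "product_independent {..<m + n} (coord_set m) (coord_adj 0 m) (semilinear m n L u)"
  unfolding product_independent_def
proof (intro conjI ballI allI impI notI)
  show "semilinear m n L u \<subseteq> Pi\<^sub>E {..<m + n} (coord_set m)" by (auto simp: semilinear_def)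
  fix z i a
  assume z: "z \<in> semilinear m n L u" and i: "i \<in> {..<m + n}" and za: "z(i := a) \<in> semilinear m n L u"
    and adj: "coord_adj 0 m i (z i) a"
  have zi: "z i \<in> coord_set m i" using z i by (auto simp: semilinear_def)
  have a: "a \<in> coord_set m i"
    using za i PiE_mem[of "z(i := a)" "{..<m + n}" "coord_set m" i] by (auto simp: semilinear_def)
  define s where "s y = (if normal_point m n y \<in> L then K2 else 0)" for y
  have tw: "total_weight m n z = u + s z" "total_weight m n (z(i := a)) = u + s (z(i := a))"
    using z za by (auto simp: semilinear_def s_def)
  then have "s (z(i := a)) = s z + (weight m i (z i) + weight m i a)"
    using total_weight_upd[of i m n z a] i by (simp add: add.assoc)
  then have sum: "weight m i (z i) + weight m i a = s z + s (z(i := a))" by simp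
  have "s z + s (z(i := a)) \<in> {0, K2}" by (auto simp: s_def zero_klein_def)
  with coord_adj_weight[OF adj zi a] sum
  have nw: "normal m i (z i) = normal m i a" "weight m i (z i) \<noteq> weight m i a" by auto
  have "normal_point m n (z(i := a)) = normal_point m n z"
    using nw(1) by (auto simp: normal_point_def fun_eq_iff)
  then have "s (z(i := a)) = s z" by (simp add: s_def)
  with sum nw(2) show False by simp
qed

lemma doob_codes_card_le:
  assumes "m + n \<ge> 1" "product_independent {..<m + n} (coord_set m) (coord_adj 0 m) C"
  shows "4 * card C \<le> card (Pi\<^sub>E {..<m + n} (coord_set m))"
proof (rule product_independent_card_le(1)[OF _ _ _ assms(2), of 0])
  show "0 \<in> {..<m + n}" using assms(1) unfolding lessThan_iff by linarith
  show "(0, 0) \<in> coord_set m 0" by (simp add: coord_set_def)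
  show "4 * card F \<le> card (coord_set m 0)" if F: "F \<subseteq> coord_set m 0" "adj_free (coord_adj 0 m 0) F" for F
  proof (cases "0 < m")
    case True
    then show ?thesis using F sh_independent_card[of F] by (simp add: coord_set_def coord_adj_def)
  next
    case False
    have "u = v" if "u \<in> F" "v \<in> F" for u v
    proof -
      have "snd u = 0" "snd v = 0" using F(1) that False by (auto simp: coord_set_def)
      moreover have "\<not> rook_adj u v" using F(2) that False by (auto simp: adj_free_def coord_adj_def)
      ultimately show ?thesis by (auto simp: rook_adj_def)
    qed
    then have "card F \<le> 1" by (auto simp: card_le_Suc0_iff_eq)
    then show ?thesis using False by (simp add: coord_set_def card_cartesian_product)
  qed
qed simp

text \<open>The four shifts partition the space, and none has more than a quarter of it, so each has
  exactly a quarter.\<close>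

lemma semilinear_in_codes:
  assumes "m + n \<ge> 1"
  shows "semilinear m n L u \<in> product_codes {..<m + n} (coord_set m) (coord_adj 0 m)"
proof -
  let ?X = "Pi\<^sub>E {..<m + n} (coord_set m)"
  have finX: "finite ?X" by (simp add: finite_PiE)
  have le: "4 * card (semilinear m n L u) \<le> card ?X" for u
    by (rule doob_codes_card_le[OF assms semilinear_independent])
  have "?X = (\<Union>u. semilinear m n L u)"
  proof -
    have "z \<in> semilinear m n L (total_weight m n z + (if normal_point m n z \<in> L then K2 else 0))" if "z \<in> ?X" for z
      using that by (simp add: semilinear_def add.assoc)
    then have "?X \<subseteq> (\<Union>u. semilinear m n L u)" by (intro subsetI UN_I[OF UNIV_I])
    moreover have "semilinear m n L u \<subseteq> ?X" for u unfolding semilinear_def by (rule Collect_restrict)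
    ultimately show ?thesis by (intro equalityI UN_least)
  qed
  moreover have "card (\<Union>u. semilinear m n L u) = (\<Sum>u\<in>UNIV. card (semilinear m n L u))"
  proof (rule card_UN_disjoint)
    show "\<forall>u\<in>UNIV. finite (semilinear m n L u)"
      using finX unfolding semilinear_def by simp
    show "\<forall>u\<in>UNIV. \<forall>v\<in>UNIV. u \<noteq> v \<longrightarrow> semilinear m n L u \<inter> semilinear m n L v = {}"
    proof (intro ballI impI equals0I)
      fix u v z assume "u \<noteq> v" "z \<in> semilinear m n L u \<inter> semilinear m n L v"
      then have "total_weight m n z = u + (if normal_point m n z \<in> L then K2 else 0)"
        "total_weight m n z = v + (if normal_point m n z \<in> L then K2 else 0)"
        unfolding semilinear_def by blast+
      then have "u + (if normal_point m n z \<in> L then K2 else 0) = v + (if normal_point m n z \<in> L then K2 else 0)"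
        by (rule subst)
      then show False using \<open>u \<noteq> v\<close> by (simp only: add_right_cancel)
    qed
  qed simp
  ultimately have "card ?X = (\<Sum>u\<in>UNIV. card (semilinear m n L u))" by simp
  then have "card ?X * card (UNIV :: klein set) \<le> (\<Sum>u\<in>UNIV. 4 * card (semilinear m n L u))"
    by (simp add: sum_distrib_left[symmetric])
  then have "4 * card (semilinear m n L u) = card ?X"
    by (intro sum_eq_bound[where B = UNIV and g = "\<lambda>u. 4 * card (semilinear m n L u)"] le) auto
  then show ?thesis using semilinear_independent by (simp add: product_codes_def)
qed

lemma normal_points_mem:
  assumes "z \<in> normal_points m n" "i < m + n"
  shows "z i \<in> (if i < m then UNIV \<times> {0} else {0, K1} \<times> {0})"
  using PiE_mem[OF assms(1)[unfolded normal_points_def], of i] assms(2) by simp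

text \<open>Second bits vanish at normal points, so their total weight is 0 or \<open>K1\<close>.
  Adding \<open>K1\<close> in coordinate 0 flips the first bit, hence at least half of them have
  weight 0.\<close>

lemma card_even_normal_points:
  assumes "m + n \<ge> 1"
  shows "2 ^ (2 * m + n - 1) \<le> card {z \<in> normal_points m n. total_weight m n z = 0}"
proof -
  let ?Z = "\<lambda>u. {z \<in> normal_points m n. total_weight m n z = u}"
  have pos: "0 < m + n" using assms by linarith
  define t where "t z = z(0 := (fst (z 0) + K1, 0 :: klein))" for z :: "nat \<Rightarrow> klein \<times> klein"
  have fin: "finite (normal_points m n)" unfolding normal_points_def by (intro finite_PiE) auto
  have tw: "total_weight m n z \<in> {0, K1}" if "z \<in> normal_points m n" for z
  proof -
    have "weight m i (z i) \<in> {0, K1}" if "i \<in> {..<m + n}" for i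
      using normal_points_mem[OF \<open>z \<in> normal_points m n\<close>, of i] that
      by (auto simp: weight_def sh_weight_def zero_klein_def split: if_splits)
    note w = this
    have "(\<Sum>i\<in>I. weight m i (z i)) \<in> {0, K1}" if "finite I" "I \<subseteq> {..<m + n}" for I
      using that
    proof (induction I rule: finite_induct)
      case (insert i I)
      then have "weight m i (z i) \<in> {0, K1}" "(\<Sum>i\<in>I. weight m i (z i)) \<in> {0, K1}" using w by auto
      then show ?case using insert.hyps by (auto simp: zero_klein_def)
    qed simp
    from this[of "{..<m + n}"] show ?thesis by (simp add: total_weight_def)
  qed
  have "inj_on t (?Z K1)"
  proof (rule inj_onI)
    fix y z assume y: "y \<in> ?Z K1" and z: "z \<in> ?Z K1" and eq: "t y = t z"
    have "snd (y 0) = 0" "snd (z 0) = 0"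
      using y z normal_points_mem[OF _ pos, of y] normal_points_mem[OF _ pos, of z]
      by (auto split: if_splits)
    moreover have "fst (y 0) = fst (z 0)" using fun_cong[OF eq, of 0] by (simp add: t_def)
    ultimately have "y 0 = z 0" by (simp add: prod_eq_iff)
    moreover have "y i = z i" if "i \<noteq> 0" for i using fun_cong[OF eq, of i] that by (simp add: t_def)
    ultimately show "y = z" by (metis ext)
  qed
  moreover have "t ` ?Z K1 \<subseteq> ?Z 0"
  proof (intro image_subsetI)
    fix z assume z: "z \<in> ?Z K1"
    have z0: "z 0 \<in> (if 0 < m then UNIV \<times> {0} else {0, K1} \<times> {0})"
      using z normal_points_mem[OF _ pos] by blast
    have "t z \<in> normal_points m n"
      unfolding t_def normal_points_def
    proof (rule PiE_upd)
      show "z \<in> Pi\<^sub>E {..<m + n} (\<lambda>i. if i < m then UNIV \<times> {0} else {0, K1} \<times> {0})"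
        using z by (simp add: normal_points_def)
      show "(fst (z 0) + K1, 0) \<in> (if 0 < m then UNIV \<times> {0} else {0, K1} \<times> {0})"
        using z0 by (auto simp: zero_klein_def split: if_splits)
    qed (use pos in simp)
    moreover have w: "weight m 0 (z 0) + weight m 0 (fst (z 0) + K1, 0) = K1"
      using z0 by (cases "fst (z 0)") (auto simp: weight_def sh_weight_def zero_klein_def split: if_splits)
    have "total_weight m n (t z) = total_weight m n z + (weight m 0 (z 0) + weight m 0 (fst (z 0) + K1, 0))"
      unfolding t_def total_weight_upd[OF pos] by (rule add.assoc)
    then have "total_weight m n (t z) = 0" using z w klein_add_self[of K1] by (metis (mono_tags, lifting) mem_Collect_eq)
    ultimately show "t z \<in> ?Z 0" by simp
  qed
  ultimately have "card (?Z K1) \<le> card (?Z 0)" using fin by (intro card_inj_on_le) auto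
  moreover have "normal_points m n = ?Z 0 \<union> ?Z K1" using tw by blast
  then have "card (normal_points m n) \<le> card (?Z 0) + card (?Z K1)" by (metis (no_types, lifting) card_Un_le)
  moreover have "card (normal_points m n) = 2 ^ (2 * m + n)"
  proof -
    have "card (normal_points m n) = (\<Prod>i<m + n. card (if i < m then (UNIV :: klein set) \<times> {0 :: klein} else {0, K1} \<times> {0}))"
      by (simp add: normal_points_def card_PiE)
    also have "\<dots> = (\<Prod>i<m + n. if i < m then 4 else 2)"
      by (intro prod.cong) (auto simp: card_cartesian_product zero_klein_def)
    also have "\<dots> = 4 ^ m * 2 ^ n"
    proof (induction n)
      case 0
      have "(\<Prod>i<m. if i < m then 4 else 2) = (\<Prod>i<m. 4 :: nat)" by (intro prod.cong) auto
      then show ?case by simp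
    qed simp
    also have "\<dots> = 2 ^ (2 * m + n)" by (simp add: power_add power_mult)
    finally show ?thesis .
  qed
  moreover have "(2 :: nat) ^ (2 * m + n) = 2 * 2 ^ (2 * m + n - 1)"
    using pos by (subst power_eq_if) auto
  ultimately show ?thesis by linarith
qed

text \<open>A normal point of weight 0 is its own normal form, so it lies in the code with shift 0
  exactly if it is not in \<open>L\<close>; thus \<open>L\<close> can be read off from the
  code.\<close>

lemma card_doob_codes_ge:
  assumes "m + n \<ge> 1"
  shows "2 ^ 2 ^ (2 * m + n - 1) \<le> card (product_codes {..<m + n} (coord_set m) (coord_adj 0 m))"
proof -
  let ?Z = "{z \<in> normal_points m n. total_weight m n z = 0}"
  have fin: "finite ?Z" unfolding normal_points_def by (intro finite_subset[OF Collect_restrict] finite_PiE) auto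
  have np: "normal_point m n z = z" "z \<in> Pi\<^sub>E {..<m + n} (coord_set m)" if "z \<in> ?Z" for z
  proof -
    have z: "z i \<in> (if i < m then UNIV \<times> {0} else {0, K1} \<times> {0})" if "i < m + n" for i
      using normal_points_mem[OF _ that] \<open>z \<in> ?Z\<close> by blast
    have ext: "z \<in> extensional {..<m + n}" using that by (auto simp: normal_points_def PiE_def)
    have "normal m i (z i) = z i" if "i < m + n" for i
      using z[OF that] by (auto simp: normal_def zero_klein_def split: if_splits)
    then show "normal_point m n z = z" using ext
      by (intro extensionalityI[where A = "{..<m + n}"]) (simp_all add: normal_point_def)
    have "z i \<in> coord_set m i" if "i < m + n" for i using z[OF that] by (auto simp: coord_set_def split: if_splits)
    then show "z \<in> Pi\<^sub>E {..<m + n} (coord_set m)" using ext by (auto simp: PiE_def)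
  qed
  have "z \<in> semilinear m n L 0 \<longleftrightarrow> z \<notin> L" if "z \<in> ?Z" for z L
    using that np[OF that] unfolding semilinear_def by (simp add: zero_klein_def)
  then have "L = ?Z - semilinear m n L 0" if "L \<subseteq> ?Z" for L using that by blast
  then have "inj_on (\<lambda>L. semilinear m n L 0) (Pow ?Z)" by (metis (no_types, lifting) PowD inj_onI)
  then have "card (Pow ?Z) \<le> card (product_codes {..<m + n} (coord_set m) (coord_adj 0 m))"
  proof (rule card_inj_on_le)
    show "(\<lambda>L. semilinear m n L 0) ` Pow ?Z \<subseteq> product_codes {..<m + n} (coord_set m) (coord_adj 0 m)"
      by (intro image_subsetI semilinear_in_codes[OF assms])
  qed (simp add: finite_product_codes)
  moreover have "card (Pow ?Z) = 2 ^ card ?Z" using fin by (simp add: card_Pow)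
  moreover have "(2::nat) ^ 2 ^ (2 * m + n - 1) \<le> 2 ^ card ?Z"
    using card_even_normal_points[OF assms] by (intro power_increasing) auto
  ultimately show ?thesis by linarith
qed

section \<open>Doob graphs\<close>

lemma four_cases: "x = 0 \<or> x = 1 \<or> x = 2 \<or> x = (3 :: 4)"
proof (cases x rule: bit0.cases)
  case (1 z)
  then have "z = 0 \<or> z = 1 \<or> z = 2 \<or> z = 3" by auto
  then show ?thesis using 1 by auto
qed

definition four_klein :: "4 \<Rightarrow> klein" where
  "four_klein x = (if x = 0 then K0 else if x = 1 then K1 else if x = 2 then K2 else K3)"

lemma four_klein_simps [simp]:
  "four_klein 0 = K0" "four_klein 1 = K1" "four_klein 2 = K2" "four_klein 3 = K3"
  by (simp_all add: four_klein_def)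

lemma four_klein_eq_iff [simp]: "four_klein x = four_klein y \<longleftrightarrow> x = y"
  using four_cases[of x] four_cases[of y] by auto

lemma bij_four_klein: "bij four_klein"
proof (rule bijI)
  show "inj four_klein" by (simp add: inj_def)
  have "\<exists>x. y = four_klein x" for y
    by (cases y) (metis four_klein_simps)+
  then show "surj four_klein" by (simp add: surj_def)
qed

lemma four_klein_add_1: "four_klein (x + 1) = cyc (four_klein x)"
proof -
  have "four_klein 4 = K0" by (simp add: four_klein_def)
  then show ?thesis using four_cases[of x] by auto
qed

definition pair_klein :: "4 \<times> 4 \<Rightarrow> klein \<times> klein" where
  "pair_klein = map_prod four_klein four_klein"

lemma pair_klein_eq_iff [simp]: "pair_klein u = pair_klein v \<longleftrightarrow> u = v"
  by (cases u; cases v) (simp add: pair_klein_def)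

lemma bij_pair_klein: "bij pair_klein"
  unfolding pair_klein_def using bij_four_klein by (metis UNIV_Times_UNIV bij_betw_map_prod)

lemma sh_next_pair_klein:
  "sh_next (pair_klein u) (pair_klein v) \<longleftrightarrow> v - u \<in> {(1, 0), (0, 1), (1, 1)}"
proof -
  have "four_klein b = cyc (four_klein a) \<longleftrightarrow> b - a = 1" for a b
    by (metis four_klein_add_1 four_klein_eq_iff diff_eq_eq add.commute)
  then show ?thesis
    by (cases u; cases v) (auto simp: sh_next_def pair_klein_def)
qed

lemma shrikhande_arcs: "(u, v) \<in> parcs shrikhande \<longleftrightarrow> sh_adj (pair_klein u) (pair_klein v)"
proof -
  have neg: "u - v = - d \<longleftrightarrow> v - u = d" for d by (metis minus_diff_eq minus_minus)
  show ?thesis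
    unfolding shrikhande_def sh_adj_def sh_next_pair_klein pair_pre_digraph.simps mem_Collect_eq prod.case
      insert_iff empty_iff neg by blast
qed

definition encode :: "nat \<Rightarrow> nat \<Rightarrow> (nat \<Rightarrow> 4 \<times> 4) \<times> (nat \<Rightarrow> 4) \<Rightarrow> nat \<Rightarrow> klein \<times> klein" where
  "encode m n p = restrict (\<lambda>i. if i < m then pair_klein (fst p i) else (four_klein (snd p (i - m)), 0)) {..<m + n}"

lemma pverts_doob: "pverts (doob m n) = ({..<m} \<rightarrow>\<^sub>E UNIV) \<times> ({..<n} \<rightarrow>\<^sub>E UNIV)"
  by (simp add: doob_def cart_prod_def cart_power_def shrikhande_def K4_def)

lemma doob_arcs:
  assumes "p \<in> pverts (doob m n)" "q \<in> pverts (doob m n)"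
  shows "(p, q) \<in> parcs (doob m n) \<longleftrightarrow>
    (\<exists>i<m. (fst p i, fst q i) \<in> parcs shrikhande \<and> (\<forall>j<m. j \<noteq> i \<longrightarrow> fst p j = fst q j)) \<and> (\<forall>j<n. snd p j = snd q j) \<or>
    (\<forall>j<m. fst p j = fst q j) \<and> (\<exists>i<n. snd p i \<noteq> snd q i \<and> (\<forall>j<n. j \<noteq> i \<longrightarrow> snd p j = snd q j))"
proof -
  obtain x y where p: "p = (x, y)" by fastforce
  obtain x' y' where q: "q = (x', y')" by fastforce
  have mem: "x \<in> {..<m} \<rightarrow>\<^sub>E UNIV" "x' \<in> {..<m} \<rightarrow>\<^sub>E UNIV" "y \<in> {..<n} \<rightarrow>\<^sub>E UNIV" "y' \<in> {..<n} \<rightarrow>\<^sub>E UNIV"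
    using assms by (auto simp: p q pverts_doob)
  have "x = x' \<longleftrightarrow> (\<forall>j<m. x j = x' j)" using mem(1,2) by (metis PiE_ext lessThan_iff)
  moreover have "y = y' \<longleftrightarrow> (\<forall>j<n. y j = y' j)" using mem(3,4) by (metis PiE_ext lessThan_iff)
  moreover have "pverts shrikhande = UNIV" "pverts K4 = UNIV" by (simp_all add: shrikhande_def K4_def)
  moreover have "(a, b) \<in> parcs K4 \<longleftrightarrow> a \<noteq> b" for a b by (simp add: K4_def)
  ultimately show ?thesis
    using mem by (simp add: p q doob_def cart_prod_def cart_power_def)
qed

lemma doob_arcs_encode:
  assumes "p \<in> pverts (doob m n)" "q \<in> pverts (doob m n)"
  shows "(p, q) \<in> parcs (doob m n) \<longleftrightarrow>
    (\<exists>i<m + n. coord_adj 0 m i (encode m n p i) (encode m n q i) \<and>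
       (\<forall>j<m + n. j \<noteq> i \<longrightarrow> encode m n p j = encode m n q j))" (is "_ \<longleftrightarrow> ?R")
proof
  have lo: "encode m n p i = pair_klein (fst p i)" if "i < m" for i p using that by (simp add: encode_def)
  have hi: "encode m n p (m + i) = (four_klein (snd p i), 0)" if "i < n" for i p using that by (simp add: encode_def)
  have split: "(\<forall>j<m + n. P j) \<longleftrightarrow> (\<forall>j<m. P j) \<and> (\<forall>j<n. P (m + j))" for P
    by (metis add_less_cancel_left le_add_diff_inverse not_less trans_less_add1)
  have adj_lo: "coord_adj 0 m i (encode m n p i) (encode m n q i) \<longleftrightarrow> (fst p i, fst q i) \<in> parcs shrikhande"
    if "i < m" for i using that by (simp add: lo coord_adj_def shrikhande_arcs)
  have adj_hi: "coord_adj 0 m (m + i) (encode m n p (m + i)) (encode m n q (m + i)) \<longleftrightarrow> snd p i \<noteq> snd q i"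
    if "i < n" for i using that by (simp add: hi coord_adj_def rook_adj_def)
  {
    assume "(p, q) \<in> parcs (doob m n)"
    then consider i where "i < m" "(fst p i, fst q i) \<in> parcs shrikhande" "\<forall>j<m. j \<noteq> i \<longrightarrow> fst p j = fst q j"
        "\<forall>j<n. snd p j = snd q j"
      | i where "\<forall>j<m. fst p j = fst q j" "i < n" "snd p i \<noteq> snd q i" "\<forall>j<n. j \<noteq> i \<longrightarrow> snd p j = snd q j"
      using doob_arcs[OF assms] by blast
    then show ?R
    proof cases
      case 1
      then show ?thesis using adj_lo[OF 1(1)] by (intro exI[of _ i]) (simp add: split lo hi)
    next
      case 2
      then show ?thesis using adj_hi[OF 2(2)] by (intro exI[of _ "m + i"]) (simp add: split lo hi)
    qed
  }
  assume ?R
  then obtain i where i: "i < m + n" "coord_adj 0 m i (encode m n p i) (encode m n q i)"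
    "\<forall>j<m + n. j \<noteq> i \<longrightarrow> encode m n p j = encode m n q j" by blast
  show "(p, q) \<in> parcs (doob m n)"
  proof (cases "i < m")
    case True
    then have "(fst p i, fst q i) \<in> parcs shrikhande" using i(2) adj_lo by blast
    moreover have "(\<forall>j<m. j \<noteq> i \<longrightarrow> fst p j = fst q j) \<and> (\<forall>j<n. snd p j = snd q j)"
      using i(3) True by (simp add: split lo hi)
    ultimately show ?thesis using doob_arcs[OF assms] True by blast
  next
    case False
    then obtain k where k: "i = m + k" "k < n" using i(1) by (metis add_less_cancel_left le_add_diff_inverse not_less)
    then have "snd p k \<noteq> snd q k" using i(2) adj_hi by blast
    moreover have "(\<forall>j<m. fst p j = fst q j) \<and> (\<forall>j<n. j \<noteq> k \<longrightarrow> snd p j = snd q j)"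
      using i(3) k by (simp add: split lo hi)
    ultimately show ?thesis using doob_arcs[OF assms] k(2) by blast
  qed
qed

lemma bij_betw_encode: "bij_betw (encode m n) (pverts (doob m n)) (Pi\<^sub>E {..<m + n} (coord_set m))"
proof (rule bij_betw_byWitness[where f' = "\<lambda>z. (restrict (\<lambda>i. inv pair_klein (z i)) {..<m},
      restrict (\<lambda>i. inv four_klein (fst (z (m + i)))) {..<n})"])
  have pk: "inv pair_klein (pair_klein a) = a" "pair_klein (inv pair_klein b) = b" for a b
    using bij_pair_klein by (simp_all add: bij_is_inj bij_is_surj surj_f_inv_f)
  have fk: "inv four_klein (four_klein a) = a" "four_klein (inv four_klein b) = b" for a b
    using bij_four_klein by (simp_all add: bij_is_inj bij_is_surj surj_f_inv_f)
  show "\<forall>p\<in>pverts (doob m n). (restrict (\<lambda>i. inv pair_klein (encode m n p i)) {..<m},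
      restrict (\<lambda>i. inv four_klein (fst (encode m n p (m + i)))) {..<n}) = p"
  proof
    fix p assume "p \<in> pverts (doob m n)"
    then have "fst p \<in> extensional {..<m}" "snd p \<in> extensional {..<n}" by (auto simp: pverts_doob PiE_def)
    then show "(restrict (\<lambda>i. inv pair_klein (encode m n p i)) {..<m},
      restrict (\<lambda>i. inv four_klein (fst (encode m n p (m + i)))) {..<n}) = p"
      by (intro prod_eqI extensionalityI[where A = "{..<m}"] extensionalityI[where A = "{..<n}"])
        (auto simp: encode_def pk fk intro!: extensionalityI[where A = "{..<m}"] extensionalityI[where A = "{..<n}"])
  qed
  show "\<forall>z\<in>Pi\<^sub>E {..<m + n} (coord_set m). encode m n (restrict (\<lambda>i. inv pair_klein (z i)) {..<m},
      restrict (\<lambda>i. inv four_klein (fst (z (m + i)))) {..<n}) = z"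
  proof
    fix z assume z: "z \<in> Pi\<^sub>E {..<m + n} (coord_set m)"
    show "encode m n (restrict (\<lambda>i. inv pair_klein (z i)) {..<m},
      restrict (\<lambda>i. inv four_klein (fst (z (m + i)))) {..<n}) = z"
    proof (rule extensionalityI[where A = "{..<m + n}"])
      fix i assume i: "i \<in> {..<m + n}"
      have zi: "z i \<in> coord_set m i" using z i by (rule PiE_mem)
      show "encode m n (restrict (\<lambda>i. inv pair_klein (z i)) {..<m},
        restrict (\<lambda>i. inv four_klein (fst (z (m + i)))) {..<n}) i = z i"
      proof (cases "i < m")
        case True
        then show ?thesis by (simp add: encode_def pk)
      next
        case False
        then have "snd (z i) = 0" using zi by (auto simp: coord_set_def)
        then have "z i = (fst (z i), 0)" by (simp add: prod_eq_iff)
        moreover have "i - m < n" using i False by auto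
        ultimately show ?thesis using i False by (simp add: encode_def fk)
      qed
    qed (use z in \<open>auto simp: encode_def PiE_def\<close>)
  qed
  show "encode m n ` pverts (doob m n) \<subseteq> Pi\<^sub>E {..<m + n} (coord_set m)"
    by (intro image_subsetI) (simp add: encode_def coord_set_def restrict_PiE_iff)
  show "(\<lambda>z. (restrict (\<lambda>i. inv pair_klein (z i)) {..<m},
      restrict (\<lambda>i. inv four_klein (fst (z (m + i)))) {..<n})) ` Pi\<^sub>E {..<m + n} (coord_set m) \<subseteq> pverts (doob m n)"
    by (intro image_subsetI) (simp add: pverts_doob)
qed

lemma independent_set_encode:
  assumes S: "S \<subseteq> pverts (doob m n)"
  shows "independent_set (doob m n) S \<longleftrightarrow>
    product_independent {..<m + n} (coord_set m) (coord_adj 0 m) (encode m n ` S)"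
proof -
  note bij = bij_betw_encode[of m n]
  have X: "encode m n ` S \<subseteq> Pi\<^sub>E {..<m + n} (coord_set m)"
    using S bij_betw_imp_surj_on[OF bij] by blast
  have arcs: "(p, q) \<in> parcs (doob m n) \<longleftrightarrow>
      (\<exists>i<m + n. coord_adj 0 m i (encode m n p i) (encode m n q i) \<and>
        encode m n q = (encode m n p)(i := encode m n q i))"
    if "p \<in> S" "q \<in> S" for p q
  proof -
    have eq: "(\<forall>j<m + n. j \<noteq> i \<longrightarrow> encode m n p j = encode m n q j) \<longleftrightarrow>
      encode m n q = (encode m n p)(i := encode m n q i)" for i
    proof
      assume *: "\<forall>j<m + n. j \<noteq> i \<longrightarrow> encode m n p j = encode m n q j"
      show "encode m n q = (encode m n p)(i := encode m n q i)"
      proof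
        fix j show "encode m n q j = ((encode m n p)(i := encode m n q i)) j"
        proof (cases "j < m + n \<and> j \<noteq> i")
          case True
          then show ?thesis using * by simp
        next
          case False
          then show ?thesis by (auto simp: encode_def)
        qed
      qed
    next
      assume "encode m n q = (encode m n p)(i := encode m n q i)"
      then show "\<forall>j<m + n. j \<noteq> i \<longrightarrow> encode m n p j = encode m n q j" by (metis fun_upd_other)
    qed
    have "p \<in> pverts (doob m n)" "q \<in> pverts (doob m n)" using that S by auto
    from doob_arcs_encode[OF this] show ?thesis unfolding eq .
  qed
  show ?thesis
  proof
    assume ind: "independent_set (doob m n) S"
    show "product_independent {..<m + n} (coord_set m) (coord_adj 0 m) (encode m n ` S)"
      unfolding product_independent_def
    proof (intro conjI ballI allI impI notI)
      show "encode m n ` S \<subseteq> Pi\<^sub>E {..<m + n} (coord_set m)" by (rule X)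
      fix z i a assume z: "z \<in> encode m n ` S" and i: "i \<in> {..<m + n}" and a: "z(i := a) \<in> encode m n ` S"
        and adj: "coord_adj 0 m i (z i) a"
      from z obtain p where p: "p \<in> S" "z = encode m n p" by (rule imageE)
      from a obtain q where q: "q \<in> S" "z(i := a) = encode m n q" by (rule imageE) auto
      have "encode m n q i = a" using q(2) by (metis fun_upd_same)
      then have "(p, q) \<in> parcs (doob m n)" using arcs[OF p(1) q(1)] p(2) q(2) i adj by auto
      with ind p(1) q(1) show False by (simp add: independent_set_def)
    qed
  next
    assume ind: "product_independent {..<m + n} (coord_set m) (coord_adj 0 m) (encode m n ` S)"
    show "independent_set (doob m n) S" unfolding independent_set_def
    proof (intro conjI ballI notI S)
      fix p q assume pq: "p \<in> S" "q \<in> S" "(p, q) \<in> parcs (doob m n)"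
      then obtain i where i: "i < m + n" "coord_adj 0 m i (encode m n p i) (encode m n q i)"
        "encode m n q = (encode m n p)(i := encode m n q i)" using arcs by blast
      have "encode m n p \<in> encode m n ` S" using pq(1) by (rule imageI)
      moreover have "(encode m n p)(i := encode m n q i) \<in> encode m n ` S"
        using imageI[OF pq(2), of "encode m n"] i(3) by simp
      ultimately show False using ind i(1,2) unfolding product_independent_def by blast
    qed
  qed
qed

text \<open>The quarter bound is attained by a semilinear code, so maximality and quarter size
  coincide. With no factors the graph is a single vertex, which has no quarter;
  \<open>m + n \<ge> 1\<close> rules that out.\<close>

theorem num_mds_eq_card_codes:
  assumes "m + n \<ge> 1"
  shows "num_mds m n = card (product_codes {..<m + n} (coord_set m) (coord_adj 0 m))"
proof -
  let ?V = "pverts (doob m n)"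
  let ?X = "Pi\<^sub>E {..<m + n} (coord_set m)"
  let ?e = "encode m n"
  let ?M = "{S. maximum_independent_set (doob m n) S}"
  note bij = bij_betw_encode[of m n]
  have inj: "inj_on ?e ?V" using bij by (rule bij_betw_imp_inj_on)
  have card_e: "card (?e ` S) = card S" if "S \<subseteq> ?V" for S
    using inj that by (meson card_image inj_on_subset)
  have pow: "bij_betw ((`) ?e) (Pow ?V) (Pow ?X)" using bij by (rule bij_betw_Pow)
  have le: "4 * card T \<le> card ?X" if "independent_set (doob m n) T" for T
  proof -
    have T: "T \<subseteq> ?V" using that by (simp add: independent_set_def)
    then show ?thesis
      using that doob_codes_card_le[OF assms, of "?e ` T"] independent_set_encode[OF T] card_e[OF T] by simp
  qed
  obtain T0 where T0: "T0 \<subseteq> ?V" "?e ` T0 = semilinear m n {} 0"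
  proof -
    have "semilinear m n {} 0 \<in> Pow ?X" by (auto simp: semilinear_def)
    then have "semilinear m n {} 0 \<in> (`) ?e ` Pow ?V" using bij_betw_imp_surj_on[OF pow] by simp
    then obtain T where "semilinear m n {} 0 = ?e ` T" "T \<in> Pow ?V" by (rule imageE)
    then show ?thesis using that[of T] by simp
  qed
  have T0': "independent_set (doob m n) T0" "4 * card T0 = card ?X"
    using semilinear_in_codes[OF assms, of "{}" 0] independent_set_encode[OF T0(1)] card_e[OF T0(1)]
    unfolding T0(2) product_codes_def by simp_all
  have "maximum_independent_set (doob m n) S \<longleftrightarrow> S \<subseteq> ?V \<and> ?e ` S \<in> product_codes {..<m + n} (coord_set m) (coord_adj 0 m)" for S
  proof -
    have "maximum_independent_set (doob m n) S \<longleftrightarrow> independent_set (doob m n) S \<and> 4 * card S = card ?X"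
    proof
      assume S: "maximum_independent_set (doob m n) S"
      then have "card T0 \<le> card S" using T0'(1) by (simp add: maximum_independent_set_def)
      then show "independent_set (doob m n) S \<and> 4 * card S = card ?X"
        using S T0'(2) le[of S] by (simp add: maximum_independent_set_def)
    next
      assume S: "independent_set (doob m n) S \<and> 4 * card S = card ?X"
      have "card T \<le> card S" if "independent_set (doob m n) T" for T using le[OF that] S by linarith
      with S show "maximum_independent_set (doob m n) S" by (simp add: maximum_independent_set_def)
    qed
    also have "\<dots> \<longleftrightarrow> S \<subseteq> ?V \<and> ?e ` S \<in> product_codes {..<m + n} (coord_set m) (coord_adj 0 m)"
    proof (cases "S \<subseteq> ?V")
      case True
      then show ?thesis using independent_set_encode[OF True] card_e[OF True] by (simp add: product_codes_def)
    qed (simp add: independent_set_def)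
    finally show ?thesis .
  qed
  then have M: "?M = {S \<in> Pow ?V. ?e ` S \<in> product_codes {..<m + n} (coord_set m) (coord_adj 0 m)}" by auto
  have "bij_betw ((`) ?e) ?M (product_codes {..<m + n} (coord_set m) (coord_adj 0 m))"
  proof (rule bij_betw_subset[OF pow])
    have sub: "product_codes {..<m + n} (coord_set m) (coord_adj 0 m) \<subseteq> (`) ?e ` Pow ?V"
      using bij_betw_imp_surj_on[OF pow] by (auto simp: product_codes_def product_independent_def)
    show "(`) ?e ` ?M = product_codes {..<m + n} (coord_set m) (coord_adj 0 m)"
    proof
      show "(`) ?e ` ?M \<subseteq> product_codes {..<m + n} (coord_set m) (coord_adj 0 m)" unfolding M by blast
      show "product_codes {..<m + n} (coord_set m) (coord_adj 0 m) \<subseteq> (`) ?e ` ?M"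
        using sub unfolding M by blast
    qed
  qed (auto simp: M)
  then show ?thesis unfolding num_mds_def by (rule bij_betw_same_card)
qed

lemma num_mds_ge: "2 * m + n \<ge> 1 \<Longrightarrow> 2 ^ 2 ^ (2 * m + n - 1) \<le> num_mds m n"
  using card_doob_codes_ge[of m n] num_mds_eq_card_codes[of m n] by (cases m) auto

lemma num_mds_le:
  assumes "2 * m + n \<ge> 2"
  defines "k \<equiv> 2 * m + n - 1"
  shows "num_mds m n \<le> 2 ^ (2 ^ k + 8 * k + 2 * chain_count k 1)"
proof -
  have "m + n \<ge> 1" using assms(1) by linarith
  then have "num_mds m n \<le> 4 ^ (4 * k) * (2 ^ 2 ^ k * 3 ^ chain_count k 1)"
    using card_doob_codes_le[OF assms(1)] num_mds_eq_card_codes[of m n] by (simp add: k_def)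
  \<comment> \<open>Replacing 3 by 4 makes every factor a power of two and only affects the exponent
    by a multiple of \<open>chain_count k 1\<close>, which is of lower order than
    \<open>2 ^ k\<close>.\<close>
  also have "\<dots> \<le> 4 ^ (4 * k) * (2 ^ 2 ^ k * 4 ^ chain_count k 1)"
    by (intro mult_left_mono power_mono) auto
  also have "(4 :: nat) ^ (4 * k) * (2 ^ 2 ^ k * 4 ^ chain_count k 1) = 2 ^ (2 * (4 * k)) * (2 ^ 2 ^ k * 2 ^ (2 * chain_count k 1))"
    by (simp only: power_mult) simp
  also have "\<dots> = 2 ^ (2 ^ k + 8 * k + 2 * chain_count k 1)"
    by (simp add: power_add)
  finally show ?thesis .
qed

theorem theorem1:
  shows "\<exists>e :: nat \<times> nat \<Rightarrow> real.
    e \<in> o[filtercomap (\<lambda>(m, n). 2 * m + n) at_top](\<lambda>_. 1) \<and>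
    (\<forall>m n :: nat. 2 * m + n \<ge> 1 \<longrightarrow>
      real (num_mds m n) = 2 powr (2 ^ (2 * m + n - 1) * (1 + e (m, n))))"
proof -
  define dim where "dim = (\<lambda>(m, n). 2 * m + n :: nat)"
  \<comment> \<open>The required equation is solved for \<open>e\<close>, so only its limit is at
    stake; it is squeezed between 0 and \<open>b\<close> of the dimension.\<close>
  define e where "e = (\<lambda>(m, n). log 2 (real (num_mds m n)) / 2 ^ (2 * m + n - 1) - 1)"
  define b where "b d = (8 * real (d - 1) + 2 * real (chain_count (d - 1) 1)) / 2 ^ (d - 1)" for d
  have pos: "0 < num_mds m n" if "2 * m + n \<ge> 1" for m n
    using num_mds_ge[OF that] by (meson less_le_trans zero_less_numeral zero_less_power)
  have eq: "real (num_mds m n) = 2 powr (2 ^ (2 * m + n - 1) * (1 + e (m, n)))" if "2 * m + n \<ge> 1" for m n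
    using pos[OF that] by (simp add: e_def)
  have bounds: "0 \<le> e p \<and> e p \<le> b (dim p)" if "dim p \<ge> 2" for p
  proof -
    obtain m n where p: "p = (m, n)" by fastforce
    define k where "k = 2 * m + n - 1"
    have d: "2 * m + n \<ge> 2" "2 * m + n \<ge> 1" using that by (auto simp: dim_def p)
    have "real (2 ^ k) \<le> log 2 (real (num_mds m n))"
      unfolding k_def by (rule le_log2_of_power[OF num_mds_ge[OF d(2)]])
    then have lo: "2 ^ k \<le> log 2 (real (num_mds m n))" by simp
    have "log 2 (real (num_mds m n)) \<le> real (2 ^ k + 8 * k + 2 * chain_count k 1)"
      unfolding k_def by (rule log2_of_power_le[OF num_mds_le[OF d(1)] pos[OF d(2)]])
    then have hi: "log 2 (real (num_mds m n)) \<le> 2 ^ k + 8 * real k + 2 * real (chain_count k 1)" by simp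
    have "0 \<le> log 2 (real (num_mds m n)) / 2 ^ k - 1" using lo by (simp add: field_simps)
    moreover have "log 2 (real (num_mds m n)) / 2 ^ k - 1 \<le> (8 * real k + 2 * real (chain_count k 1)) / 2 ^ k"
    proof -
      have "log 2 (real (num_mds m n)) / 2 ^ k \<le> (2 ^ k + 8 * real k + 2 * real (chain_count k 1)) / 2 ^ k"
        using hi by (intro divide_right_mono) auto
      then show ?thesis by (simp add: add_divide_distrib)
    qed
    ultimately show ?thesis by (simp add: e_def b_def dim_def p k_def)
  qed
  have k0: "(\<lambda>k. real k / 2 ^ k) \<longlonglongrightarrow> 0"
    using lim_n_over_pown[of "2 :: real"] by simp
  have "(\<lambda>k. 8 * (real k / 2 ^ k) + 2 * (real (chain_count k 1) / 2 ^ k)) \<longlonglongrightarrow> 8 * 0 + 2 * 0"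
    by (intro tendsto_intros chain_count_tendsto_0 k0)
  then have "(\<lambda>k. b (Suc k)) \<longlonglongrightarrow> 0" by (simp add: b_def add_divide_distrib)
  then have b0: "b \<longlonglongrightarrow> 0" by (simp only: filterlim_sequentially_Suc)
  have dim: "filterlim dim at_top (filtercomap dim at_top)" by (rule filterlim_filtercomap)
  have "\<forall>\<^sub>F p in filtercomap dim at_top. dim p \<ge> 2"
    using dim by (simp add: filterlim_at_top)
  then have "\<forall>\<^sub>F p in filtercomap dim at_top. 0 \<le> e p" "\<forall>\<^sub>F p in filtercomap dim at_top. e p \<le> b (dim p)"
    using bounds by (auto elim: eventually_mono)
  then have "(e \<longlongrightarrow> 0) (filtercomap dim at_top)"
    using filterlim_compose[OF b0 dim] by (intro tendsto_sandwich[of "\<lambda>_. 0" e _ "\<lambda>p. b (dim p)"]) auto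
  then have "e \<in> o[filtercomap dim at_top](\<lambda>_. 1)" by (intro smalloI_tendsto) auto
  with eq show ?thesis unfolding dim_def by blast
qed

end
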